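(* Let $h\colon\subseteq[0,1]\to\mathbb{R}$ be a computable function that is defined and non-decreasing on an effectively closed class $\mathcal{C}\subseteq[0,1]$. Then $h\restriction\mathcal{C}$ can be extended to a non-decreasing computable function $\hat h\colon[0,1]\to\mathbb{R}$.
   Context: Effectively closed: complement is the union of an effective sequence of open intervals with rational endpoints. A Cauchy name for $x$ is a sequence of rationals $(q_n)$ with $|x-q_n|\le2^{-n}$; a (partial) function $f\colon\subseteq\mathbb{R}\to\mathbb{R}$ is computable if there is a computable functional mapping every Cauchy name of any $x\in\mathrm{dom}(f)$ to a Cauchy name of $f(x)$. *)

theory Defs
  imports Complex_Main "HOL-Library.Countable"
begin

text \<open>
  Programs for partial recursive functions relative to an oracle
  \<open>\<alpha> : nat \<Rightarrow> nat\<close>. \<open>Cn\<close> is composition, \<open>Pr\<close> is primitive recursion on the first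
  argument, and \<open>Mn\<close> is unbounded minimisation over the first argument. Arities are not tracked:
  a program applied to too few arguments is undefined where it needs a missing one.
\<close>

datatype recf =
    Zero
  | Succ
  | Proj nat
  | Oracle
  | Cn recf "recf list"
  | Pr recf recf
  | Mn recf

fun eval :: "(nat \<Rightarrow> nat) \<Rightarrow> recf \<Rightarrow> nat list \<Rightarrow> nat option" where
  "eval \<alpha> Zero xs = Some 0"
| "eval \<alpha> Succ xs = (case xs of [] \<Rightarrow> None | x # _ \<Rightarrow> Some (Suc x))"
| "eval \<alpha> (Proj i) xs = (if i < length xs then Some (xs ! i) else None)"
| "eval \<alpha> Oracle xs = (case xs of [] \<Rightarrow> None | x # _ \<Rightarrow> Some (\<alpha> x))"
| "eval \<alpha> (Cn f gs) xs = Option.bind (those (map (\<lambda>g. eval \<alpha> g xs) gs)) (eval \<alpha> f)"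
| "eval \<alpha> (Pr f g) xs =
     (case xs of
        [] \<Rightarrow> None
      | n # ys \<Rightarrow> rec_nat (eval \<alpha> f ys)
                   (\<lambda>k r. Option.bind r (\<lambda>v. eval \<alpha> g (k # v # ys))) n)"
| "eval \<alpha> (Mn f) xs =
     (if \<exists>n. eval \<alpha> f (n # xs) = Some 0 \<and> (\<forall>m<n. eval \<alpha> f (m # xs) \<noteq> None)
      then Some (LEAST n. eval \<alpha> f (n # xs) = Some 0)
      else None)"

fun oracle_free :: "recf \<Rightarrow> bool" where
  "oracle_free Oracle \<longleftrightarrow> False"
| "oracle_free (Cn f gs) \<longleftrightarrow> oracle_free f \<and> (\<forall>g\<in>set gs. oracle_free g)"
| "oracle_free (Pr f g) \<longleftrightarrow> oracle_free f \<and> oracle_free g"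
| "oracle_free (Mn f) \<longleftrightarrow> oracle_free f"
| "oracle_free _ \<longleftrightarrow> True"

text \<open>An oracle-free program ignores \<open>\<alpha>\<close>, so the quantifier over oracles below is immaterial.\<close>

definition computable_nat :: "(nat \<Rightarrow> nat) \<Rightarrow> bool" where
  "computable_nat f \<longleftrightarrow> (\<exists>p. oracle_free p \<and> (\<forall>\<alpha> n. eval \<alpha> p [n] = Some (f n)))"

text \<open>
  Sequences of rationals are represented by sequences of codes. The numbering
  \<open>nat_to_rat_surj\<close> is onto and effective: it decodes a pair of integers, numerator and
  denominator, a zero denominator giving \<open>0\<close>.
\<close>

definition computable_rat_seq :: "(nat \<Rightarrow> rat) \<Rightarrow> bool" where
  "computable_rat_seq q \<longleftrightarrow> (\<exists>e. computable_nat e \<and> (\<forall>n. q n = nat_to_rat_surj (e n)))"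

text \<open>Intervals with \<open>b i \<le> a i\<close> are empty, so the sequence may also be empty in effect.\<close>

definition effectively_closed :: "real set \<Rightarrow> bool" where
  "effectively_closed C \<longleftrightarrow>
     (\<exists>a b. computable_rat_seq a \<and> computable_rat_seq b \<and>
            - C = (\<Union>i. {real_of_rat (a i) <..< real_of_rat (b i)}))"

definition cauchy_name :: "(nat \<Rightarrow> nat) \<Rightarrow> real \<Rightarrow> bool" where
  "cauchy_name \<alpha> x \<longleftrightarrow> (\<forall>n. \<bar>x - real_of_rat (nat_to_rat_surj (\<alpha> n))\<bar> \<le> 1 / 2 ^ n)"

text \<open>
  A computable functional is given by a single program, with the name of the argument as its
  oracle. It must be total on names of points of \<open>dom f\<close>, and it is unconstrained on all other
  oracles.
\<close>

definition computable_real :: "(real \<rightharpoonup> real) \<Rightarrow> bool" where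
  "computable_real f \<longleftrightarrow>
     (\<exists>p. \<forall>x y \<alpha>. f x = Some y \<longrightarrow> cauchy_name \<alpha> x \<longrightarrow>
        (\<exists>\<beta>. (\<forall>n. eval \<alpha> p [n] = Some (\<beta> n)) \<and> cauchy_name \<beta> y))"

end

theory Submission
  imports Defs "HOL-Analysis.Analysis"
begin

text \<open>
  A cut at level \<open>q < q'\<close> is a short interval such that every \<open>x \<in> C\<close> with \<open>h x \<le> q\<close> lies to its left
  and every \<open>x \<in> C\<close> with \<open>h x \<ge> q'\<close> to its right. Cuts exist because \<open>C\<close> is compact and \<open>h\<close> is continuous
  and monotone on \<open>C\<close>, and by compactness a finite certificate shows that a given interval is a cut, so
  that one can be found by search. Adding up ramps across the cuts at the levels \<open>i / 2\<^sup>n\<close> gives computable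
  non-decreasing Lipschitz functions \<open>g n\<close> with \<open>\<bar>g n - h\<bar> \<le> 2\<^sup>-\<^sup>n\<close> on \<open>C\<close>. Clamping \<open>g (n + 1)\<close> to
  within \<open>2\<^sup>-\<^sup>n\<close> of the previous clamped function keeps monotonicity and, as clamping fixes \<open>h\<close> on \<open>C\<close>, the
  approximation; it also makes the sequence converge uniformly on all of the line, with a computable limit.
\<close>

section \<open>Computability over numbered types\<close>

text \<open>The obvious extension, the supremum of \<open>h y\<close> over the y in C with y \<le>
  x, need not be continuous: it can jump at a gap of C. Values in the gaps have to be invented, and
  no place for a jump is canonical, since the endpoints of \<open>{x \<in> C. h x \<le> q}\<close>
  are not computable in general. The distance between q and q' is what makes the search end: it
  leaves room for a separation with positive margins, and such a separation can be recognised from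
  finitely much information, namely enumerated intervals off C and finite prefixes of names on C.
  Prefixes are used because a program for h may diverge on names of points outside its domain, so
  that only runs seen to halt may count. Cuts for different n come from unrelated searches, so off C
  the functions \<open>g n\<close> and \<open>g (n + 1)\<close> may be far apart; hence the clamping
  before the passage to the limit. A bound on the modulus of h over C enters the programs as a fixed
  constant.\<close>

definition recursive :: "(nat \<Rightarrow> nat) \<Rightarrow> bool" where
  "recursive F \<longleftrightarrow> (\<exists>p. \<forall>\<alpha> c. eval \<alpha> p [c] = Some (F c))"

definition recursive2 :: "(nat \<Rightarrow> nat \<Rightarrow> nat) \<Rightarrow> bool" where
  "recursive2 F \<longleftrightarrow> (\<exists>p. \<forall>\<alpha> a b. eval \<alpha> p [a, b] = Some (F a b))"

lemma recursiveI: "(\<And>\<alpha> c. eval \<alpha> p [c] = Some (F c)) \<Longrightarrow> recursive F"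
  unfolding recursive_def by blast

lemma recursive2I: "(\<And>\<alpha> a b. eval \<alpha> p [a, b] = Some (F a b)) \<Longrightarrow> recursive2 F"
  unfolding recursive2_def by blast

lemma recursive_id: "recursive (\<lambda>c. c)"
  by (rule recursiveI[of "Proj 0"]) simp

lemma recursive_Suc: "recursive Suc"
  by (rule recursiveI[of Succ]) simp

lemma recursive_compose:
  assumes "recursive F" "recursive G"
  shows "recursive (\<lambda>c. F (G c))"
proof -
  obtain p q where "\<And>\<alpha> c. eval \<alpha> p [c] = Some (F c)" "\<And>\<alpha> c. eval \<alpha> q [c] = Some (G c)"
    using assms unfolding recursive_def by blast
  then show ?thesis
    by (intro recursiveI[of "Cn p [q]"]) simp
qed

lemma recursive2_compose:
  assumes "recursive2 F" "recursive G" "recursive H"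
  shows "recursive (\<lambda>c. F (G c) (H c))"
proof -
  obtain p q r where "\<And>\<alpha> a b. eval \<alpha> p [a, b] = Some (F a b)"
    "\<And>\<alpha> c. eval \<alpha> q [c] = Some (G c)" "\<And>\<alpha> c. eval \<alpha> r [c] = Some (H c)"
    using assms unfolding recursive_def recursive2_def by blast
  then show ?thesis
    by (intro recursiveI[of "Cn p [q, r]"]) simp
qed

lemma recursive2_compose2:
  assumes "recursive2 F" "recursive2 G" "recursive2 H"
  shows "recursive2 (\<lambda>a b. F (G a b) (H a b))"
proof -
  obtain p q r where "\<And>\<alpha> a b. eval \<alpha> p [a, b] = Some (F a b)"
    "\<And>\<alpha> a b. eval \<alpha> q [a, b] = Some (G a b)" "\<And>\<alpha> a b. eval \<alpha> r [a, b] = Some (H a b)"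
    using assms unfolding recursive2_def by blast
  then show ?thesis
    by (intro recursive2I[of "Cn p [q, r]"]) simp
qed

lemma recursive_compose2:
  assumes "recursive F" "recursive2 G"
  shows "recursive2 (\<lambda>a b. F (G a b))"
proof -
  obtain p q where "\<And>\<alpha> c. eval \<alpha> p [c] = Some (F c)"
    "\<And>\<alpha> a b. eval \<alpha> q [a, b] = Some (G a b)"
    using assms unfolding recursive_def recursive2_def by blast
  then show ?thesis
    by (intro recursive2I[of "Cn p [q]"]) simp
qed

lemma recursive2_fst: "recursive2 (\<lambda>a b. a)"
  by (rule recursive2I[of "Proj 0"]) simp

lemma recursive2_snd: "recursive2 (\<lambda>a b. b)"
  by (rule recursive2I[of "Proj 1"]) simp

lemma recursive_const: "recursive (\<lambda>_. k)"
proof (induction k)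
  case 0
  show ?case by (rule recursiveI[of Zero]) simp
next
  case (Suc k)
  show ?case by (rule recursive_compose[OF recursive_Suc Suc])
qed

lemma recursive2_add: "recursive2 (+)"
proof (rule recursive2I[of "Pr (Proj 0) (Cn Succ [Proj 1])"])
  show "eval \<alpha> (Pr (Proj 0) (Cn Succ [Proj 1])) [a, b] = Some (a + b)" for \<alpha> a b
    by (induction a) auto
qed

lemma recursive_triangle: "recursive triangle"
proof -
  obtain p where p: "\<And>\<alpha> a b. eval \<alpha> p [a, b] = Some (a + b)"
    using recursive2_add unfolding recursive2_def by blast
  show ?thesis
  proof (rule recursiveI[of "Pr Zero (Cn p [Proj 1, Cn Succ [Proj 0]])"])
    show "eval \<alpha> (Pr Zero (Cn p [Proj 1, Cn Succ [Proj 0]])) [n] = Some (triangle n)" for \<alpha> n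
      by (induction n) (auto simp: p)
  qed
qed

lemma recursive2_pair: "recursive2 (\<lambda>a b. prod_encode (a, b))"
  unfolding prod_encode_def split_conv
  by (intro recursive2_compose2[OF recursive2_add] recursive_compose2[OF recursive_triangle]
      recursive2_add recursive2_fst)

lemma recursive_pred: "recursive (\<lambda>n. n - 1)"
proof (rule recursiveI[of "Pr Zero (Proj 0)"])
  show "eval \<alpha> (Pr Zero (Proj 0)) [n] = Some (n - 1)" for \<alpha> n
    by (induction n) auto
qed

lemma recursive2_diff: "recursive2 (-)"
proof -
  obtain p where p: "\<And>\<alpha> c. eval \<alpha> p [c] = Some (c - 1)"
    using recursive_pred unfolding recursive_def by blast
  have "eval \<alpha> (Pr (Proj 0) (Cn p [Proj 1])) [b, a] = Some (a - b)" for \<alpha> a b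
    by (induction b) (auto simp: p)
  then have "recursive2 (\<lambda>b a. a - b)"
    by (rule recursive2I)
  from recursive2_compose2[OF this recursive2_snd recursive2_fst] show ?thesis .
qed

lemma recursive_search:
  assumes "recursive2 F" "\<And>c. \<exists>n. F n c = 0"
  shows "recursive (\<lambda>c. LEAST n. F n c = 0)"
proof -
  obtain p where "\<And>\<alpha> a b. eval \<alpha> p [a, b] = Some (F a b)"
    using assms(1) unfolding recursive2_def by blast
  then show ?thesis
    using assms(2) by (intro recursiveI[of "Mn p"]) simp
qed

lemma triangle_mono: "m \<le> n \<Longrightarrow> triangle m \<le> triangle n"
  by (induction rule: dec_induct) auto

text \<open>As \<open>prod_encode (a, b) = triangle (a + b) + a\<close> and a \<le> a + b, the code
  lies between two consecutive triangle numbers, which determines a + b. Truncated subtraction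
  expresses that the code is below \<open>triangle (Suc k)\<close>, in the form that a search for a
  zero requires.\<close>

lemma Least_triangle: "(LEAST k. Suc (prod_encode (a, b)) - triangle (Suc k) = 0) = a + b"
proof (rule Least_equality)
  show "Suc (prod_encode (a, b)) - triangle (Suc (a + b)) = 0"
    by (simp add: prod_encode_def)
next
  fix k assume *: "Suc (prod_encode (a, b)) - triangle (Suc k) = 0"
  show "a + b \<le> k"
  proof (rule ccontr)
    assume "\<not> a + b \<le> k"
    then have "triangle (Suc k) \<le> triangle (a + b)"
      by (intro triangle_mono) auto
    with * show False
      by (simp add: prod_encode_def)
  qed
qed

lemma recursive_decode_sum: "recursive (\<lambda>c. fst (prod_decode c) + snd (prod_decode c))"
proof -
  let ?F = "\<lambda>k c. Suc c - triangle (Suc k)"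
  have eq: "(LEAST k. ?F k c = 0) = fst (prod_decode c) + snd (prod_decode c)" for c
    using Least_triangle[of "fst (prod_decode c)" "snd (prod_decode c)"] by simp
  have "recursive (\<lambda>c. LEAST k. ?F k c = 0)"
  proof (rule recursive_search)
    show "recursive2 ?F"
      by (intro recursive2_compose2[OF recursive2_diff] recursive_compose2[OF recursive_Suc]
          recursive_compose2[OF recursive_triangle] recursive2_fst recursive2_snd)
    show "\<exists>k. ?F k c = 0" for c
      by (intro exI[of _ c]) simp
  qed
  then show ?thesis
    by (simp only: eq)
qed

lemma recursive_fst: "recursive (\<lambda>c. fst (prod_decode c))"
proof -
  have "c - triangle (fst (prod_decode c) + snd (prod_decode c)) = fst (prod_decode c)" for c
    using prod_decode_inverse[of c] by (cases "prod_decode c") (auto simp: prod_encode_def)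
  moreover have "recursive (\<lambda>c. c - triangle (fst (prod_decode c) + snd (prod_decode c)))"
    by (intro recursive2_compose[OF recursive2_diff] recursive_id
        recursive_compose[OF recursive_triangle] recursive_decode_sum)
  ultimately show ?thesis
    by simp
qed

lemma recursive_snd: "recursive (\<lambda>c. snd (prod_decode c))"
proof -
  have "recursive (\<lambda>c. (fst (prod_decode c) + snd (prod_decode c)) - fst (prod_decode c))"
    by (intro recursive2_compose[OF recursive2_diff] recursive_decode_sum recursive_fst)
  then show ?thesis
    by simp
qed

text \<open>Parameter, index and previous value are packed into one number because
  \<open>recursive\<close> deals with one argument. The nesting of the pairs is the one by which
  \<open>dec\<close> reads a triple, which \<open>computable_rec_nat\<close> exploits.\<close>

lemma recursive_rec_nat:
  assumes "recursive F" "recursive G" "recursive N"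
  shows "recursive (\<lambda>c. rec_nat (F c) (\<lambda>k r. G (prod_encode (c, prod_encode (k, r)))) (N c))"
proof -
  obtain pf pg pn pp where
    pf: "\<And>\<alpha> c. eval \<alpha> pf [c] = Some (F c)" and
    pg: "\<And>\<alpha> c. eval \<alpha> pg [c] = Some (G c)" and
    pn: "\<And>\<alpha> c. eval \<alpha> pn [c] = Some (N c)" and
    pp: "\<And>\<alpha> a b. eval \<alpha> pp [a, b] = Some (prod_encode (a, b))"
    using assms recursive2_pair unfolding recursive_def recursive2_def by blast
  define p where "p = Pr pf (Cn pg [Cn pp [Proj 2, Cn pp [Proj 0, Proj 1]]])"
  have "eval \<alpha> p [n, c] = Some (rec_nat (F c) (\<lambda>k r. G (prod_encode (c, prod_encode (k, r)))) n)"
    for \<alpha> n c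
    unfolding p_def by (induction n) (auto simp: pf pg pn pp)
  then have "eval \<alpha> (Cn p [pn, Proj 0]) [c] =
      Some (rec_nat (F c) (\<lambda>k r. G (prod_encode (c, prod_encode (k, r)))) (N c))" for \<alpha> c
    by (simp add: pn)
  then show ?thesis
    by (rule recursiveI)
qed

section \<open>Types with a surjective numbering\<close>

class numbered =
  fixes dec :: "nat \<Rightarrow> 'a"
  assumes surj_dec: "surj dec"

instantiation nat :: numbered
begin
definition dec_nat :: "nat \<Rightarrow> nat" where "dec_nat c = c"
instance by standard (auto simp: dec_nat_def surj_def)
end

instantiation bool :: numbered
begin
definition dec_bool :: "nat \<Rightarrow> bool" where "dec_bool c \<longleftrightarrow> c \<noteq> 0"
instance
proof
  have "P = dec (if P then 1 else 0)" for P
    by (simp add: dec_bool_def)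
  then show "surj (dec :: nat \<Rightarrow> bool)"
    unfolding surj_def by blast
qed
end

instantiation int :: numbered
begin
definition dec_int :: "nat \<Rightarrow> int" where "dec_int = int_decode"
instance by standard (auto simp: dec_int_def surj_int_decode)
end

instantiation rat :: numbered
begin
definition dec_rat :: "nat \<Rightarrow> rat" where "dec_rat = nat_to_rat_surj"
instance by standard (auto simp: dec_rat_def surj_nat_to_rat_surj)
end

instantiation prod :: (numbered, numbered) numbered
begin
definition dec_prod :: "nat \<Rightarrow> 'a \<times> 'b" where
  "dec_prod c = map_prod dec dec (prod_decode c)"
instance
proof
  have "\<exists>c. dec c = y" for y :: "'a \<times> 'b"
  proof -
    obtain a b where "dec a = fst y" "dec b = snd y"
      using surj_dec[where 'a='a] surj_dec[where 'a='b] by (metis surjD)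
    then show ?thesis
      by (intro exI[of _ "prod_encode (a, b)"]) (simp add: dec_prod_def)
  qed
  then show "surj (dec :: nat \<Rightarrow> 'a \<times> 'b)"
    unfolding surj_def by metis
qed
end

instantiation option :: (numbered) numbered
begin
definition dec_option :: "nat \<Rightarrow> 'a option" where
  "dec_option c = (case c of 0 \<Rightarrow> None | Suc d \<Rightarrow> Some (dec d))"
instance
proof
  have "\<exists>c. dec c = y" for y :: "'a option"
  proof (cases y)
    case None
    then show ?thesis
      by (intro exI[of _ 0]) (simp add: dec_option_def)
  next
    case (Some x)
    obtain d where "dec d = x"
      using surj_dec by (metis surjD)
    with Some show ?thesis
      by (intro exI[of _ "Suc d"]) (simp add: dec_option_def)
  qed
  then show "surj (dec :: nat \<Rightarrow> 'a option)"
    unfolding surj_def by metis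
qed
end

instantiation list :: (numbered) numbered
begin
definition dec_list :: "nat \<Rightarrow> 'a list" where
  "dec_list c = map dec (list_decode c)"
instance
proof
  have "\<exists>c. dec c = xs" for xs :: "'a list"
  proof -
    have "\<exists>ds. xs = map dec ds"
      using surj_dec[where 'a='a] by (auto simp: ex_map_conv surj_def)
    then obtain ds where "xs = map dec ds"
      by blast
    then show ?thesis
      by (intro exI[of _ "list_encode ds"]) (simp add: dec_list_def)
  qed
  then show "surj (dec :: nat \<Rightarrow> 'a list)"
    unfolding surj_def by metis
qed
end

text \<open>F tracks f on codes; a value may have many codes, and F need not respect that. Since F
  is total, a computable predicate is decidable, and a computable map into an option type decides
  whether its result is \<open>None\<close>.\<close>

definition computable :: "('a::numbered \<Rightarrow> 'b::numbered) \<Rightarrow> bool" where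
  "computable f \<longleftrightarrow> (\<exists>F. recursive F \<and> (\<forall>c. dec (F c) = f (dec c)))"

named_theorems computable_intros

lemma computableI:
  assumes "recursive F" "\<And>c. dec (F c) = f (dec c)"
  shows "computable f"
  using assms unfolding computable_def by blast

lemma computable_nat_iff: "computable (f :: nat \<Rightarrow> nat) \<longleftrightarrow> recursive f"
proof -
  have "(\<forall>c. F c = f c) \<longleftrightarrow> F = f" for F
    by (simp add: fun_eq_iff)
  then show ?thesis
    unfolding computable_def dec_nat_def by simp
qed

lemma computable_id [computable_intros]: "computable (\<lambda>x. x)"
  by (rule computableI[OF recursive_id]) simp

lemma computable_const [computable_intros]: "computable (\<lambda>_. k)"
proof -
  obtain c where "dec c = k"
    using surj_dec by (metis surjD)
  then show ?thesis
    by (intro computableI[OF recursive_const[of c]]) simp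
qed

lemma computable_compose:
  assumes "computable f" "computable g"
  shows "computable (\<lambda>x. f (g x))"
proof -
  obtain F where "recursive F" "\<And>c. dec (F c) = f (dec c)"
    using assms(1) unfolding computable_def by blast
  moreover obtain G where "recursive G" "\<And>c. dec (G c) = g (dec c)"
    using assms(2) unfolding computable_def by blast
  ultimately show ?thesis
    by (intro computableI[OF recursive_compose, of F G]) simp_all
qed

lemma computable_Pair [computable_intros]:
  assumes "computable f" "computable g"
  shows "computable (\<lambda>x. (f x, g x))"
proof -
  obtain F where "recursive F" "\<And>c. dec (F c) = f (dec c)"
    using assms(1) unfolding computable_def by blast
  moreover obtain G where "recursive G" "\<And>c. dec (G c) = g (dec c)"
    using assms(2) unfolding computable_def by blast
  ultimately show ?thesis
    by (intro computableI[OF recursive2_compose[OF recursive2_pair], of F G])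
      (simp_all add: dec_prod_def)
qed

lemma computable_fst [computable_intros]:
  assumes "computable f" shows "computable (\<lambda>x. fst (f x))"
proof (rule computable_compose[OF _ assms])
  show "computable (fst :: 'b \<times> 'c \<Rightarrow> 'b)"
    by (rule computableI[OF recursive_fst]) (simp add: dec_prod_def)
qed

lemma computable_snd [computable_intros]:
  assumes "computable f" shows "computable (\<lambda>x. snd (f x))"
proof (rule computable_compose[OF _ assms])
  show "computable (snd :: 'b \<times> 'c \<Rightarrow> 'c)"
    by (rule computableI[OF recursive_snd]) (simp add: dec_prod_def)
qed

lemma computable_compose2:
  assumes "computable (\<lambda>y. f (fst y) (snd y))" "computable g" "computable h"
  shows "computable (\<lambda>x. f (g x) (h x))"
  using computable_compose[OF assms(1) computable_Pair[OF assms(2,3)]] by simp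

lemma computable_uncurry2:
  fixes f :: "'a::numbered \<Rightarrow> 'b::numbered \<Rightarrow> 'c::numbered"
  assumes "recursive2 F" "\<And>a b. dec (F a b) = f (dec a) (dec b)"
  shows "computable (\<lambda>y. f (fst y) (snd y))"
  by (rule computableI[OF recursive2_compose[OF assms(1) recursive_fst recursive_snd]])
    (simp add: assms(2) dec_prod_def)

lemma computable_Suc [computable_intros]:
  "computable f \<Longrightarrow> computable (\<lambda>x. Suc (f x))"
  by (rule computable_compose[of Suc]) (simp_all add: computable_nat_iff recursive_Suc)

lemma computable_add_nat [computable_intros]:
  fixes f g :: "'a::numbered \<Rightarrow> nat"
  shows "computable f \<Longrightarrow> computable g \<Longrightarrow> computable (\<lambda>x. f x + g x)"
  by (rule computable_compose2[OF computable_uncurry2[OF recursive2_add]])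
    (simp_all add: dec_nat_def)

lemma computable_diff_nat [computable_intros]:
  fixes f g :: "'a::numbered \<Rightarrow> nat"
  shows "computable f \<Longrightarrow> computable g \<Longrightarrow> computable (\<lambda>x. f x - g x)"
  by (rule computable_compose2[OF computable_uncurry2[OF recursive2_diff]])
    (simp_all add: dec_nat_def)

lemma computable_rec_nat [computable_intros]:
  fixes f :: "'a::numbered \<Rightarrow> 'b::numbered"
  assumes "computable f"
    and "computable (\<lambda>y. g (fst y) (fst (snd y)) (snd (snd y)))"
    and "computable n"
  shows "computable (\<lambda>x. rec_nat (f x) (\<lambda>k r. g x k r) (n x))"
proof -
  obtain F where F: "recursive F" "\<And>c. dec (F c) = f (dec c)"
    using assms(1) unfolding computable_def by blast
  obtain G where G: "recursive G"
    "\<And>c. dec (G c) = (\<lambda>y. g (fst y) (fst (snd y)) (snd (snd y))) (dec c)"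
    using assms(2) unfolding computable_def by blast
  obtain N where N: "recursive N" "\<And>c. dec (N c) = n (dec c)"
    using assms(3) unfolding computable_def by blast
  have *: "dec (rec_nat (F c) (\<lambda>k r. G (prod_encode (c, prod_encode (k, r)))) m) =
      rec_nat (f (dec c)) (\<lambda>k r. g (dec c) k r) m" for c m
    by (induction m) (simp_all add: F G dec_prod_def dec_nat_def)
  show ?thesis
    by (rule computableI[OF recursive_rec_nat[OF F(1) G(1) N(1)]]) (simp add: * N(2)[symmetric] dec_nat_def)
qed

lemma computable_case_nat [computable_intros]:
  assumes "computable f" "computable (\<lambda>y. g (fst y) (snd y))" "computable n"
  shows "computable (\<lambda>x. case n x of 0 \<Rightarrow> f x | Suc k \<Rightarrow> g x k)"
proof -
  have "computable (\<lambda>x. rec_nat (f x) (\<lambda>k r. g x k) (n x))"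
    by (intro computable_rec_nat computable_compose2[OF assms(2)] assms computable_intros)
  moreover have "rec_nat (f x) (\<lambda>k r. g x k) (n x) =
      (case n x of 0 \<Rightarrow> f x | Suc k \<Rightarrow> g x k)" for x
    by (cases "n x") simp_all
  ultimately show ?thesis by simp
qed

section \<open>Booleans and decidable relations\<close>

lemma computable_If [computable_intros]:
  assumes "computable P" "computable f" "computable g"
  shows "computable (\<lambda>x. if P x then f x else g x)"
proof -
  obtain F where F: "recursive F" "\<And>c. dec (F c) = P (dec c)"
    using assms(1) unfolding computable_def by blast
  obtain G where G: "recursive G" "\<And>c. dec (G c) = f (dec c)"
    using assms(2) unfolding computable_def by blast
  obtain H where H: "recursive H" "\<And>c. dec (H c) = g (dec c)"
    using assms(3) unfolding computable_def by blast
  have "computable (\<lambda>c. case F c of 0 \<Rightarrow> H c | Suc k \<Rightarrow> G c)"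
    using F(1) G(1) H(1) unfolding computable_nat_iff[symmetric]
    by (intro computable_case_nat computable_compose[of G "\<lambda>y. fst y"] computable_intros)
  then show ?thesis
    unfolding computable_nat_iff
  proof (rule computableI)
    show "dec (case F c of 0 \<Rightarrow> H c | Suc k \<Rightarrow> G c) =
        (if P (dec c) then f (dec c) else g (dec c))" for c
      using F(2)[of c] by (cases "F c") (auto simp: G H dec_bool_def)
  qed
qed

lemma computable_not [computable_intros]:
  "computable P \<Longrightarrow> computable (\<lambda>x. \<not> P x)"
  using computable_If[OF _ computable_const[of False] computable_const[of True], of P]
  by (simp add: if_bool_eq_conj)

lemma computable_conj [computable_intros]:
  "computable P \<Longrightarrow> computable Q \<Longrightarrow> computable (\<lambda>x. P x \<and> Q x)"
  using computable_If[OF _ _ computable_const[of False], of P Q]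
  by (simp add: if_bool_eq_disj)

lemma computable_disj [computable_intros]:
  "computable P \<Longrightarrow> computable Q \<Longrightarrow> computable (\<lambda>x. P x \<or> Q x)"
  using computable_not[OF computable_conj[OF computable_not computable_not, of P Q]] by simp

lemma computable_imp [computable_intros]:
  "computable P \<Longrightarrow> computable Q \<Longrightarrow> computable (\<lambda>x. P x \<longrightarrow> Q x)"
  using computable_disj[OF computable_not, of P Q] by simp

lemma computable_le_nat [computable_intros]:
  fixes f g :: "'a::numbered \<Rightarrow> nat"
  assumes "computable f" "computable g"
  shows "computable (\<lambda>x. f x \<le> g x)"
proof -
  have "computable (\<lambda>x. case f x - g x of 0 \<Rightarrow> True | Suc _ \<Rightarrow> False)"
    by (intro assms computable_intros)
  moreover have "(case f x - g x of 0 \<Rightarrow> True | Suc _ \<Rightarrow> False) \<longleftrightarrow> f x \<le> g x" for x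
    by (auto split: nat.split)
  ultimately show ?thesis by simp
qed

lemma computable_eq_nat [computable_intros]:
  fixes f g :: "'a::numbered \<Rightarrow> nat"
  shows "computable f \<Longrightarrow> computable g \<Longrightarrow> computable (\<lambda>x. f x = g x)"
  using computable_conj[OF computable_le_nat computable_le_nat, of f g g f]
  by (simp add: eq_iff)

lemma computable_ex_less [computable_intros]:
  fixes P :: "'a::numbered \<Rightarrow> nat \<Rightarrow> bool"
  assumes "computable (\<lambda>y. P (fst y) (snd y))" "computable n"
  shows "computable (\<lambda>x. \<exists>i<n x. P x i)"
proof -
  have "rec_nat False (\<lambda>i r. r \<or> P x i) m \<longleftrightarrow> (\<exists>i<m. P x i)" for x m
    by (induction m) (auto simp: less_Suc_eq)
  moreover have "computable (\<lambda>x. rec_nat False (\<lambda>i r. r \<or> P x i) (n x))"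
    by (intro computable_compose2[OF assms(1)] assms(2) computable_intros)
  ultimately show ?thesis by simp
qed

lemma computable_all_less [computable_intros]:
  fixes P :: "'a::numbered \<Rightarrow> nat \<Rightarrow> bool"
  assumes "computable (\<lambda>y. P (fst y) (snd y))" "computable n"
  shows "computable (\<lambda>x. \<forall>i<n x. P x i)"
  using computable_not[OF computable_ex_less[of "\<lambda>x i. \<not> P x i" n]]
    computable_not[OF assms(1)] assms(2) by simp

lemma computable_Least:
  fixes P :: "'a::numbered \<Rightarrow> nat \<Rightarrow> bool"
  assumes "computable (\<lambda>y. P (fst y) (snd y))" "\<And>x. \<exists>n. P x n"
  shows "computable (\<lambda>x. LEAST n. P x n)"
proof -
  obtain F where F: "recursive F" "\<And>c. dec (F c) = (\<lambda>y. \<not> P (fst y) (snd y)) (dec c)"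
    using computable_not[OF assms(1)] unfolding computable_def by blast
  have *: "F (prod_encode (c, n)) = 0 \<longleftrightarrow> P (dec c) n" for c n
    using F(2)[of "prod_encode (c, n)"] by (auto simp: dec_prod_def dec_nat_def dec_bool_def)
  have "recursive2 (\<lambda>n c. F (prod_encode (c, n)))"
    by (intro recursive_compose2[OF F(1)] recursive2_compose2[OF recursive2_pair]
        recursive2_fst recursive2_snd)
  then have "recursive (\<lambda>c. LEAST n. F (prod_encode (c, n)) = 0)"
    by (rule recursive_search) (use assms(2) in \<open>simp add: *\<close>)
  then show ?thesis
    by (rule computableI) (simp add: * dec_nat_def)
qed

section \<open>Options and lists\<close>

lemma computable_Some [computable_intros]:
  assumes "computable f"
  shows "computable (\<lambda>x. Some (f x))"
  by (rule computable_compose[of Some, OF _ assms], rule computableI[OF recursive_Suc])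
    (simp add: dec_option_def)

lemma computable_case_option [computable_intros]:
  assumes "computable f" "computable (\<lambda>y. g (fst y) (snd y))" "computable w"
  shows "computable (\<lambda>x. case w x of None \<Rightarrow> f x | Some v \<Rightarrow> g x v)"
proof -
  obtain F where F: "recursive F" "\<And>c. dec (F c) = f (dec c)"
    using assms(1) unfolding computable_def by blast
  obtain G where G: "recursive G" "\<And>c. dec (G c) = (\<lambda>y. g (fst y) (snd y)) (dec c)"
    using assms(2) unfolding computable_def by blast
  obtain W where W: "recursive W" "\<And>c. dec (W c) = w (dec c)"
    using assms(3) unfolding computable_def by blast
  have "computable (\<lambda>c. case W c of 0 \<Rightarrow> F c | Suc d \<Rightarrow> G (prod_encode (c, d)))"
  proof (intro computable_case_nat)
    show "computable F" "computable W"
      using F(1) W(1) by (simp_all add: computable_nat_iff)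
    have "recursive (\<lambda>y. G (prod_encode (fst (prod_decode y), snd (prod_decode y))))"
      by (intro recursive_compose[OF G(1)] recursive2_compose[OF recursive2_pair]
          recursive_fst recursive_snd)
    then show "computable (\<lambda>y :: nat \<times> nat. G (prod_encode (fst y, snd y)))"
      by (rule computableI) (simp add: dec_prod_def dec_nat_def)
  qed
  then show ?thesis
    unfolding computable_nat_iff
  proof (rule computableI)
    show "dec (case W c of 0 \<Rightarrow> F c | Suc d \<Rightarrow> G (prod_encode (c, d))) =
        (case w (dec c) of None \<Rightarrow> f (dec c) | Some v \<Rightarrow> g (dec c) v)" for c
      unfolding W(2)[symmetric]
      by (cases "W c") (simp_all add: F G dec_option_def dec_prod_def)
  qed
qed

lemma computable_bind [computable_intros]:
  assumes "computable w" "computable (\<lambda>y. g (fst y) (snd y))"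
  shows "computable (\<lambda>x. Option.bind (w x) (\<lambda>v. g x v))"
proof -
  have "Option.bind (w x) (\<lambda>v. g x v) = (case w x of None \<Rightarrow> None | Some v \<Rightarrow> g x v)" for x
    by (cases "w x") simp_all
  with computable_case_option[OF computable_const[of None] assms(2,1)] show ?thesis
    by simp
qed

lemma computable_is_None [computable_intros]:
  assumes "computable w"
  shows "computable (\<lambda>x. w x = None)"
proof -
  have "computable (\<lambda>x. case w x of None \<Rightarrow> True | Some _ \<Rightarrow> False)"
    by (intro assms computable_intros)
  moreover have "(case w x of None \<Rightarrow> True | Some _ \<Rightarrow> False) \<longleftrightarrow> w x = None" for x
    by (cases "w x") simp_all
  ultimately show ?thesis by simp
qed

lemma computable_eq_Some_nat [computable_intros]:
  fixes w :: "'a::numbered \<Rightarrow> nat option"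
  assumes "computable w" "computable f"
  shows "computable (\<lambda>x. w x = Some (f x))"
proof -
  have "computable (\<lambda>x. case w x of None \<Rightarrow> False | Some v \<Rightarrow> v = f x)"
    by (intro assms computable_compose[OF assms(2)] computable_intros)
  moreover have "(case w x of None \<Rightarrow> False | Some v \<Rightarrow> v = f x) \<longleftrightarrow> w x = Some (f x)" for x
    by (cases "w x") simp_all
  ultimately show ?thesis by simp
qed

lemma computable_Cons [computable_intros]:
  fixes f :: "'a::numbered \<Rightarrow> 'b::numbered"
  assumes "computable f" "computable l"
  shows "computable (\<lambda>x. f x # l x)"
proof (rule computable_compose2[OF _ assms])
  have "recursive2 (\<lambda>a b. Suc (prod_encode (a, b)))"
    by (rule recursive_compose2[OF recursive_Suc recursive2_pair])
  then show "computable (\<lambda>y :: 'b \<times> 'b list. fst y # snd y)"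
    by (rule computable_uncurry2) (simp add: dec_list_def)
qed

lemma computable_case_list [computable_intros]:
  fixes f :: "'a::numbered \<Rightarrow> 'b::numbered" and l :: "'a \<Rightarrow> 'c::numbered list"
  assumes "computable f" "computable (\<lambda>y. g (fst y) (fst (snd y)) (snd (snd y)))" "computable l"
  shows "computable (\<lambda>x. case l x of [] \<Rightarrow> f x | v # vs \<Rightarrow> g x v vs)"
proof -
  define uncons :: "'c list \<Rightarrow> ('c \<times> 'c list) option"
    where "uncons vs = (case vs of [] \<Rightarrow> None | v # vs \<Rightarrow> Some (v, vs))" for vs
  \<comment> \<open>\<open>list_decode\<close> sends 0 to the empty list and the successor of a pair
    code to a cons, which is exactly how codes of \<open>('c \<times> 'c list) option\<close> are
    read. Hence the identity on codes tracks \<open>uncons\<close>.\<close>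
  have "computable uncons"
    by (rule computableI[OF recursive_id])
      (auto simp: uncons_def dec_list_def dec_option_def dec_prod_def split: nat.split prod.split)
  then have "computable (\<lambda>x. case uncons (l x) of None \<Rightarrow> f x | Some p \<Rightarrow> g x (fst p) (snd p))"
    using assms(1,2) by (intro computable_case_option computable_compose[of uncons l] assms(3))
  moreover have "(case uncons (l x) of None \<Rightarrow> f x | Some p \<Rightarrow> g x (fst p) (snd p)) =
      (case l x of [] \<Rightarrow> f x | v # vs \<Rightarrow> g x v vs)" for x
    by (cases "l x") (simp_all add: uncons_def)
  ultimately show ?thesis by simp
qed

lemma computable_drop [computable_intros]:
  fixes l :: "'a::numbered \<Rightarrow> 'b::numbered list"
  assumes "computable n" "computable l"
  shows "computable (\<lambda>x. drop (n x) (l x))"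
proof -
  have "rec_nat vs (\<lambda>k r. case r of [] \<Rightarrow> [] | w # ws \<Rightarrow> ws) m = drop m vs" for vs :: "'b list" and m
  proof (induction m)
    case (Suc m)
    then show ?case
      by (cases "drop m vs") (auto simp: drop_Suc tl_drop[symmetric] simp del: tl_drop)
  qed simp
  moreover have "computable (\<lambda>x. rec_nat (l x) (\<lambda>k r. case r of [] \<Rightarrow> [] | w # ws \<Rightarrow> ws) (n x))"
    by (intro assms computable_intros)
  ultimately show ?thesis by simp
qed

lemma computable_length [computable_intros]:
  fixes l :: "'a::numbered \<Rightarrow> 'b::numbered list"
  assumes "computable l"
  shows "computable (\<lambda>x. length (l x))"
proof -
  have "(LEAST n. case drop n (l x) of [] \<Rightarrow> True | _ # _ \<Rightarrow> False) = length (l x)" for x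
    by (rule Least_equality) (auto split: list.splits)
  moreover have "computable (\<lambda>x. LEAST n. case drop n (l x) of [] \<Rightarrow> True | _ # _ \<Rightarrow> False)"
  proof (rule computable_Least)
    show "computable (\<lambda>y. case drop (snd y) (l (fst y)) of [] \<Rightarrow> True | _ # _ \<Rightarrow> False)"
      by (intro computable_compose[OF assms] computable_intros)
    show "\<exists>n. case drop n (l x) of [] \<Rightarrow> True | _ # _ \<Rightarrow> False" for x
      by (rule exI[of _ "length (l x)"]) simp
  qed
  ultimately show ?thesis by simp
qed

text \<open>\<open>!\<close> has no specified value beyond the length, so the entry is read as the
  head of \<open>drop m\<close>. The answer for an empty remainder is arbitrary, as the bound on m
  excludes that case.\<close>

lemma computable_all_nth [computable_intros]:
  fixes l :: "'a::numbered \<Rightarrow> 'b::numbered list"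
  assumes "computable (\<lambda>y. P (fst y) (fst (snd y)) (snd (snd y)))" "computable l"
  shows "computable (\<lambda>x. \<forall>m<length (l x). P x m (l x ! m))"
proof -
  have "(\<forall>m<length (l x). P x m (l x ! m)) \<longleftrightarrow>
      (\<forall>m<length (l x). case drop m (l x) of [] \<Rightarrow> True | r # _ \<Rightarrow> P x m r)" for x
    by (intro all_cong) (simp add: Cons_nth_drop_Suc[symmetric])
  moreover have "computable (\<lambda>x. \<forall>m<length (l x). case drop m (l x) of [] \<Rightarrow> True | r # _ \<Rightarrow> P x m r)"
  proof -
    have "computable (\<lambda>y. P (fst (fst y)) (snd (fst y)) (fst (snd y)))"
      using computable_compose[OF assms(1), of "\<lambda>y. (fst (fst y), snd (fst y), fst (snd y))"]
      by (simp add: computable_intros)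
    then show ?thesis
      by (intro computable_all_less computable_case_list computable_compose[OF assms(2)]
          computable_intros assms(2))
  qed
  ultimately show ?thesis by simp
qed

lemma computable_those_map:
  assumes "\<And>g. g \<in> set gs \<Longrightarrow> computable (e g)"
  shows "computable (\<lambda>x. those (map (\<lambda>g. e g x) gs))"
  using assms
proof (induction gs)
  case Nil
  then show ?case by (simp add: computable_const)
next
  case (Cons g gs)
  have "computable (\<lambda>x. Option.bind (e g x) (\<lambda>v. Option.bind (those (map (\<lambda>g. e g x) gs))
      (\<lambda>vs. Some (v # vs))))"
    using Cons by (intro computable_intros computable_compose[of "\<lambda>x. those (map (\<lambda>g. e g x) gs)" fst])
      simp_all
  moreover have "Option.bind (e g x) (\<lambda>v. Option.bind (those (map (\<lambda>g. e g x) gs))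
      (\<lambda>vs. Some (v # vs))) = those (map (\<lambda>g. e g x) (g # gs))" for x
    by (auto split: option.splits simp: bind_eq_Some_conv Option.bind_def map_option_case)
  ultimately show ?case by simp
qed

section \<open>Evaluation with a finite part of the oracle\<close>

text \<open>The length of \<open>\<sigma>\<close> also bounds every minimisation, so that \<open>feval\<close> always terminates.\<close>

fun feval :: "nat list \<Rightarrow> recf \<Rightarrow> nat list \<Rightarrow> nat option" where
  "feval \<sigma> Zero xs = Some 0"
| "feval \<sigma> Succ xs = (case xs of [] \<Rightarrow> None | x # _ \<Rightarrow> Some (Suc x))"
| "feval \<sigma> (Proj i) xs = (case drop i xs of [] \<Rightarrow> None | x # _ \<Rightarrow> Some x)"
| "feval \<sigma> Oracle xs =
     (case xs of [] \<Rightarrow> None | x # _ \<Rightarrow> (case drop x \<sigma> of [] \<Rightarrow> None | y # _ \<Rightarrow> Some y))"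
| "feval \<sigma> (Cn f gs) xs = Option.bind (those (map (\<lambda>g. feval \<sigma> g xs) gs)) (feval \<sigma> f)"
| "feval \<sigma> (Pr f g) xs =
     (case xs of
        [] \<Rightarrow> None
      | n # ys \<Rightarrow> rec_nat (feval \<sigma> f ys)
                   (\<lambda>k r. Option.bind r (\<lambda>v. feval \<sigma> g (k # v # ys))) n)"
| "feval \<sigma> (Mn f) xs =
     (if \<exists>n<length \<sigma>. feval \<sigma> f (n # xs) = Some 0 \<and> (\<forall>m<n. feval \<sigma> f (m # xs) \<noteq> None)
      then Some (LEAST n. feval \<sigma> f (n # xs) = Some 0)
      else None)"

text \<open>The program p is fixed and the induction runs over it, giving one tracking function per
  program. Thus programs are never coded as numbers and no universal machine is built.\<close>

lemma computable_feval_aux: "computable (\<lambda>y. feval (fst y) p (snd y))"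
proof (induction p)
  case Zero
  show ?case by (simp, intro computable_intros)
next
  case Succ
  show ?case by (simp, intro computable_intros)
next
  case (Proj i)
  show ?case by (simp, intro computable_intros)
next
  case Oracle
  show ?case by (simp, intro computable_intros)
next
  case (Cn f gs)
  have "computable (\<lambda>y. those (map (\<lambda>g. feval (fst y) g (snd y)) gs))"
    using Cn.IH(2) by (rule computable_those_map)
  then show ?case
    by (simp, intro computable_compose2[OF Cn.IH(1)] computable_intros)
next
  case (Pr f g)
  show ?case
    by (simp, intro computable_compose2[OF Pr.IH(1)] computable_compose2[OF Pr.IH(2)]
        computable_intros)
next
  case (Mn f)
  define B where "B y \<longleftrightarrow> (\<exists>n<length (fst y). feval (fst y) f (n # snd y) = Some 0 \<and>
      (\<forall>m<n. feval (fst y) f (m # snd y) \<noteq> None))" for y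
  have B: "computable B"
    unfolding B_def by (intro computable_compose2[OF Mn.IH] computable_intros)
  \<comment> \<open>\<open>computable_Least\<close> demands a witness for every y. The disjunct
    \<open>\<not> B y\<close> supplies one where the search would fail and is false wherever the
    result is used.\<close>
  have L: "computable (\<lambda>y. LEAST n. \<not> B y \<or> feval (fst y) f (n # snd y) = Some 0)"
    by (intro computable_Least computable_compose2[OF Mn.IH] computable_compose[OF B]
        computable_intros) (auto simp: B_def)
  have "feval (fst y) (Mn f) (snd y) =
      (if B y then Some (LEAST n. \<not> B y \<or> feval (fst y) f (n # snd y) = Some 0) else None)" for y
  proof -
    have "feval (fst y) (Mn f) (snd y) =
        (if B y then Some (LEAST n. feval (fst y) f (n # snd y) = Some 0) else None)"
      by (simp only: feval.simps B_def)
    then show ?thesis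
      by (simp cong: if_cong)
  qed
  with L show ?case
    by (simp only:) (intro B computable_intros)
qed

lemma computable_feval [computable_intros]:
  "computable s \<Longrightarrow> computable l \<Longrightarrow> computable (\<lambda>x. feval (s x) p (l x))"
  by (rule computable_compose2[OF computable_feval_aux])

lemma those_eq_Some_iff:
  "those xs = Some ys \<longleftrightarrow> xs = map Some ys"
proof (induction xs arbitrary: ys)
  case (Cons x xs)
  then show ?case
    by (cases x; cases ys) (auto split: option.splits)
qed auto

lemma rec_nat_bind_mono:
  assumes "\<And>v. a = Some v \<Longrightarrow> b = Some v"
    and "\<And>k r v. k < n \<Longrightarrow> g k r = Some v \<Longrightarrow> g' k r = Some v"
    and "rec_nat a (\<lambda>k r. Option.bind r (g k)) n = Some v"
  shows "rec_nat b (\<lambda>k r. Option.bind r (g' k)) n = Some v"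
  using assms(2,3) by (induction n arbitrary: v) (auto simp: bind_eq_Some_conv assms(1))

lemma drop_eq_ConsD: "drop n xs = y # ys \<Longrightarrow> n < length xs \<and> y = xs ! n"
  by (metis drop_eq_Nil2 linorder_not_less list.distinct(1) nth_via_drop)

text \<open>A bounded run that yields a value has read only entries of \<sigma>, so every oracle
  that begins with \<sigma> leads to the same value.\<close>

lemma feval_sound:
  assumes "\<And>n. n < length \<sigma> \<Longrightarrow> \<sigma> ! n = \<alpha> n" "feval \<sigma> p xs = Some v"
  shows "eval \<alpha> p xs = Some v"
  using assms(2)
proof (induction p arbitrary: xs v)
  case (Proj i)
  then show ?case
    by (cases "i < length xs") (auto simp: Cons_nth_drop_Suc[symmetric])
next
  case Oracle
  then show ?case
    by (cases xs) (auto split: list.splits dest!: drop_eq_ConsD simp: assms(1))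
next
  case (Cn f gs)
  then obtain ys where ys: "map (\<lambda>g. feval \<sigma> g xs) gs = map Some ys" "feval \<sigma> f ys = Some v"
    by (auto simp: bind_eq_Some_conv those_eq_Some_iff)
  have "map (\<lambda>g. eval \<alpha> g xs) gs = map Some ys"
    using ys(1) Cn.IH(2) by (auto simp: list_eq_iff_nth_eq)
  with ys(2) Cn.IH(1) show ?case
    by (auto simp: bind_eq_Some_conv those_eq_Some_iff)
next
  case (Pr f g)
  obtain n ys where xs: "xs = n # ys"
    using Pr.prems by (auto split: list.splits)
  have "rec_nat (feval \<sigma> f ys) (\<lambda>k r. Option.bind r (\<lambda>v. feval \<sigma> g (k # v # ys))) n = Some v"
    using Pr.prems unfolding xs by simp
  then have "rec_nat (eval \<alpha> f ys) (\<lambda>k r. Option.bind r (\<lambda>v. eval \<alpha> g (k # v # ys))) n = Some v"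
    by (rule rec_nat_bind_mono[rotated 2]) (simp_all add: Pr.IH)
  then show ?case
    unfolding xs by simp
next
  case (Mn f)
  then obtain n where n: "feval \<sigma> f (n # xs) = Some 0" "\<forall>m<n. feval \<sigma> f (m # xs) \<noteq> None"
    and v: "v = (LEAST n. feval \<sigma> f (n # xs) = Some 0)"
    by (auto split: if_splits)
  have v': "feval \<sigma> f (v # xs) = Some 0" "v \<le> n"
    using n(1) unfolding v by (auto intro: LeastI Least_le)
  \<comment> \<open>Below v every bounded evaluation is defined, by the condition on n, so the
    induction hypothesis carries its value over. As none of these values is 0, the unbounded search
    cannot stop before v.\<close>
  have e: "eval \<alpha> f (m # xs) = feval \<sigma> f (m # xs)" if "m < v" for m
  proof -
    obtain u where "feval \<sigma> f (m # xs) = Some u"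
      using n(2) v'(2) \<open>m < v\<close> by (meson not_None_eq order_less_le_trans)
    with Mn.IH show ?thesis
      by simp
  qed
  have e0: "eval \<alpha> f (v # xs) = Some 0"
    using Mn.IH v' by blast
  have "(LEAST n. eval \<alpha> f (n # xs) = Some 0) = v"
  proof (rule Least_equality)
    show "v \<le> m" if "eval \<alpha> f (m # xs) = Some 0" for m
      using that e[of m] not_less_Least[of m "\<lambda>n. feval \<sigma> f (n # xs) = Some 0"] v
      by (cases "m < v") auto
  qed (rule e0)
  moreover have "\<exists>n. eval \<alpha> f (n # xs) = Some 0 \<and> (\<forall>m<n. eval \<alpha> f (m # xs) \<noteq> None)"
    using e0 n(2) v'(2) by (intro exI[of _ v]) (auto simp: e)
  ultimately show ?case
    by simp
qed (auto split: list.splits)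

text \<open>A halting computation queries its oracle finitely often. The claim is made for all L'
  \<ge> L, so that the maximum of the bounds for finitely many subcomputations serves all of
  them.\<close>

lemma feval_complete:
  assumes "eval \<alpha> p xs = Some v"
  shows "\<exists>L. \<forall>L'\<ge>L. feval (map \<alpha> [0..<L']) p xs = Some v"
  using assms
proof (induction p arbitrary: xs v)
  case (Proj i)
  then have "drop i xs = xs ! i # drop (Suc i) xs"
    by (auto split: if_splits simp: Cons_nth_drop_Suc)
  with Proj show ?case
    by (auto split: if_splits)
next
  case Oracle
  then obtain x ys where xs: "xs = x # ys" "v = \<alpha> x"
    by (auto split: list.splits)
  have "feval (map \<alpha> [0..<L']) Oracle xs = Some v" if "L' \<ge> Suc x" for L'
  proof -
    have "drop x (map \<alpha> [0..<L']) = \<alpha> x # drop (Suc x) (map \<alpha> [0..<L'])"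
      using that by (subst Cons_nth_drop_Suc[symmetric]) auto
    with xs show ?thesis
      by simp
  qed
  then show ?case by blast
next
  case (Cn f gs)
  then obtain ys where ys: "map (\<lambda>g. eval \<alpha> g xs) gs = map Some ys" "eval \<alpha> f ys = Some v"
    by (auto simp: bind_eq_Some_conv those_eq_Some_iff)
  obtain L0 where L0: "\<And>L'. L' \<ge> L0 \<Longrightarrow> feval (map \<alpha> [0..<L']) f ys = Some v"
    using Cn.IH(1)[OF ys(2)] by blast
  have "\<forall>i\<in>{..<length gs}. \<exists>L. \<forall>L'\<ge>L. feval (map \<alpha> [0..<L']) (gs ! i) xs = Some (ys ! i)"
  proof
    fix i assume "i \<in> {..<length gs}"
    with ys(1) have "eval \<alpha> (gs ! i) xs = Some (ys ! i)" "gs ! i \<in> set gs"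
      by (auto simp: list_eq_iff_nth_eq)
    then show "\<exists>L. \<forall>L'\<ge>L. feval (map \<alpha> [0..<L']) (gs ! i) xs = Some (ys ! i)"
      by (rule Cn.IH(2)[rotated])
  qed
  then obtain L where L: "\<And>i L'. i < length gs \<Longrightarrow> L' \<ge> L i \<Longrightarrow>
      feval (map \<alpha> [0..<L']) (gs ! i) xs = Some (ys ! i)"
    by (metis lessThan_iff)
  define K where "K = Max (insert L0 (L ` {..<length gs}))"
  have K: "L0 \<le> K" "\<And>i. i < length gs \<Longrightarrow> L i \<le> K"
    unfolding K_def by auto
  have "feval (map \<alpha> [0..<L']) (Cn f gs) xs = Some v" if "L' \<ge> K" for L'
  proof -
    have "length gs = length ys"
      using ys(1) by (metis length_map)
    then have "map (\<lambda>g. feval (map \<alpha> [0..<L']) g xs) gs = map Some ys"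
      using L K(2) that by (auto simp: list_eq_iff_nth_eq intro: order_trans)
    then show ?thesis
      using L0[of L'] K(1) that by (auto simp: bind_eq_Some_conv those_eq_Some_iff)
  qed
  then show ?case by blast
next
  case (Pr f g)
  obtain n ys where xs: "xs = n # ys"
    using Pr.prems by (auto split: list.splits)
  let ?r = "\<lambda>n. rec_nat (eval \<alpha> f ys) (\<lambda>k r. Option.bind r (\<lambda>v. eval \<alpha> g (k # v # ys))) n"
  let ?s = "\<lambda>L n. rec_nat (feval (map \<alpha> [0..<L]) f ys)
      (\<lambda>k r. Option.bind r (\<lambda>v. feval (map \<alpha> [0..<L]) g (k # v # ys))) n"
  have "\<exists>L. \<forall>L'\<ge>L. ?s L' n = Some v" if "?r n = Some v" for v
    using that
  proof (induction n arbitrary: v)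
    case 0
    then show ?case using Pr.IH(1) by simp
  next
    case (Suc n)
    then obtain u where u: "?r n = Some u" "eval \<alpha> g (n # u # ys) = Some v"
      by (auto simp: bind_eq_Some_conv)
    obtain L1 where L1: "\<And>L'. L' \<ge> L1 \<Longrightarrow> ?s L' n = Some u"
      using Suc.IH[OF u(1)] by blast
    obtain L2 where L2: "\<And>L'. L' \<ge> L2 \<Longrightarrow> feval (map \<alpha> [0..<L']) g (n # u # ys) = Some v"
      using Pr.IH(2)[OF u(2)] by blast
    have "\<forall>L'\<ge>max L1 L2. ?s L' (Suc n) = Some v"
      using L1 L2 by simp
    then show ?case by blast
  qed
  with Pr.prems show ?case
    unfolding xs by simp
next
  case (Mn f)
  then have ex: "\<exists>n. eval \<alpha> f (n # xs) = Some 0 \<and> (\<forall>m<n. eval \<alpha> f (m # xs) \<noteq> None)"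
    and v: "v = (LEAST n. eval \<alpha> f (n # xs) = Some 0)"
    by (auto split: if_splits)
  then obtain n where n: "eval \<alpha> f (n # xs) = Some 0" "\<forall>m<n. eval \<alpha> f (m # xs) \<noteq> None"
    by blast
  have v': "eval \<alpha> f (v # xs) = Some 0" "v \<le> n"
    using n(1) unfolding v by (auto intro: LeastI Least_le)
  have "\<exists>L. \<forall>L'\<ge>L. feval (map \<alpha> [0..<L']) f (m # xs) = eval \<alpha> f (m # xs)" if "m \<le> v" for m
  proof -
    have "eval \<alpha> f (m # xs) \<noteq> None"
      using n v' that by (cases "m = v") auto
    then show ?thesis
      using Mn.IH by auto
  qed
  then obtain L where L: "\<And>m L'. m \<le> v \<Longrightarrow> L' \<ge> L m \<Longrightarrow>
      feval (map \<alpha> [0..<L']) f (m # xs) = eval \<alpha> f (m # xs)"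
    by metis
  \<comment> \<open>\<open>Suc v\<close> is included because the length of the prefix also limits
    the minimisation, which must be able to reach v.\<close>
  define K where "K = Max (insert (Suc v) (L ` {..v}))"
  have K: "v < K" "\<And>m. m \<le> v \<Longrightarrow> L m \<le> K"
    unfolding K_def Suc_le_eq[symmetric] by (intro Max_ge; auto)+
  have "feval (map \<alpha> [0..<L']) (Mn f) xs = Some v" if "L' \<ge> K" for L'
  proof -
    have e: "feval (map \<alpha> [0..<L']) f (m # xs) = eval \<alpha> f (m # xs)" if "m \<le> v" for m
      using L[OF that] K(2)[OF that] \<open>L' \<ge> K\<close> by simp
    have "(LEAST n. feval (map \<alpha> [0..<L']) f (n # xs) = Some 0) = v"
    proof (rule Least_equality)
      show "feval (map \<alpha> [0..<L']) f (v # xs) = Some 0"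
        using e v' by simp
      show "v \<le> m" if "feval (map \<alpha> [0..<L']) f (m # xs) = Some 0" for m
        using that e[of m] Least_le[of "\<lambda>n. eval \<alpha> f (n # xs) = Some 0" m] v
        by (cases "m \<le> v") auto
    qed
    moreover have "\<exists>n<length (map \<alpha> [0..<L']). feval (map \<alpha> [0..<L']) f (n # xs) = Some 0 \<and>
        (\<forall>m<n. feval (map \<alpha> [0..<L']) f (m # xs) \<noteq> None)"
      using e v' n K(1) that by (intro exI[of _ v]) auto
    ultimately show ?thesis
      by simp
  qed
  then show ?case by blast
qed simp_all

section \<open>Integer and rational arithmetic\<close>

lemma computable_mult_nat [computable_intros]:
  fixes f g :: "'a::numbered \<Rightarrow> nat"
  assumes "computable f" "computable g"
  shows "computable (\<lambda>x. f x * g x)"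
proof -
  have "rec_nat 0 (\<lambda>k r. r + b) a = a * b" for a b :: nat
    by (induction a) auto
  moreover have "computable (\<lambda>x. rec_nat 0 (\<lambda>k r. r + g x) (f x))"
    by (intro assms computable_compose[OF assms(2)] computable_intros)
  ultimately show ?thesis by simp
qed

lemma computable_power_nat [computable_intros]:
  fixes f g :: "'a::numbered \<Rightarrow> nat"
  assumes "computable f" "computable g"
  shows "computable (\<lambda>x. f x ^ g x)"
proof -
  have "rec_nat 1 (\<lambda>k r. a * r) b = a ^ b" for a b :: nat
    by (induction b) auto
  moreover have "computable (\<lambda>x. rec_nat 1 (\<lambda>k r. f x * r) (g x))"
    by (intro assms computable_compose[OF assms(1)] computable_intros)
  ultimately show ?thesis by simp
qed

lemma computable_even [computable_intros]:
  fixes f :: "'a::numbered \<Rightarrow> nat"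
  assumes "computable f"
  shows "computable (\<lambda>x. even (f x))"
proof -
  have "rec_nat True (\<lambda>k r. \<not> r) n = even n" for n
    by (induction n) auto
  moreover have "computable (\<lambda>x. rec_nat True (\<lambda>k r. \<not> r) (f x))"
    by (intro assms computable_intros)
  ultimately show ?thesis by simp
qed

lemma computable_half [computable_intros]:
  fixes f :: "'a::numbered \<Rightarrow> nat"
  assumes "computable f"
  shows "computable (\<lambda>x. f x div 2)"
proof -
  have "rec_nat 0 (\<lambda>k r. if even k then r else Suc r) n = n div 2" for n
    by (induction n) auto
  moreover have "computable (\<lambda>x. rec_nat 0 (\<lambda>k r. if even k then r else Suc r) (f x))"
    by (intro assms computable_intros)
  ultimately show ?thesis by simp
qed

lemma computable_from_code:
  fixes K :: "nat \<Rightarrow> 'b::numbered"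
  assumes "computable K" "\<And>c. K c = f (dec c)"
  shows "computable f"
  using assms unfolding computable_def dec_nat_def by simp

lemma computable_into_code:
  fixes K :: "'a::numbered \<Rightarrow> nat"
  assumes "computable K" "\<And>x. dec (K x) = f x"
  shows "computable f"
proof -
  obtain F where "recursive F" "\<And>c. F c = K (dec c)"
    using assms(1) unfolding computable_def dec_nat_def by blast
  then show ?thesis
    by (intro computableI[of F]) (simp_all add: assms(2))
qed

lemma computable_decode [computable_intros]:
  fixes f :: "'a::numbered \<Rightarrow> nat"
  assumes "computable f"
  shows "computable (\<lambda>x. dec (f x) :: 'b::numbered)"
  by (rule computable_into_code[OF assms]) simp

section \<open>Integers as differences of natural numbers\<close>

lemma computable_nat_int [computable_intros]:
  fixes f :: "'a::numbered \<Rightarrow> int"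
  assumes "computable f"
  shows "computable (\<lambda>x. nat (f x))"
proof (rule computable_compose[OF _ assms], rule computable_from_code)
  show "computable (\<lambda>c. if even c then c div 2 else 0 :: nat)"
    by (intro computable_intros)
qed (simp add: dec_int_def int_decode_def sum_decode_def)

lemma computable_nat_uminus_int [computable_intros]:
  fixes f :: "'a::numbered \<Rightarrow> int"
  assumes "computable f"
  shows "computable (\<lambda>x. nat (- f x))"
proof (rule computable_compose[OF _ assms], rule computable_from_code)
  show "computable (\<lambda>c. if even c then 0 else Suc (c div 2))"
    by (intro computable_intros)
qed (auto simp: dec_int_def int_decode_def sum_decode_def)

text \<open>\<open>int_decode\<close> numbers d \<ge> 0 by \<open>2 * d\<close> and - d, for d > 0,
  by \<open>2 * d - 1\<close>. With \<open>nat z\<close> and \<open>nat (- z)\<close> as positive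
  and negative part, integer arithmetic then reduces to natural numbers.\<close>

lemma computable_int_diff:
  assumes "computable f" "computable g"
  shows "computable (\<lambda>x. int (f x) - int (g x))"
proof (rule computable_into_code)
  show "computable (\<lambda>x. if g x \<le> f x then 2 * (f x - g x) else 2 * (g x - f x) - 1)"
    by (intro assms computable_intros)
qed (auto simp: dec_int_def int_decode_def sum_decode_def of_nat_diff)

lemma computable_int [computable_intros]:
  assumes "computable f" shows "computable (\<lambda>x. int (f x))"
  using computable_int_diff[OF assms computable_const[of 0]] by simp

lemma computable_add_int [computable_intros]:
  fixes f g :: "'a::numbered \<Rightarrow> int"
  assumes "computable f" "computable g"
  shows "computable (\<lambda>x. f x + g x)"
proof -
  have "computable (\<lambda>x. int (nat (f x) + nat (g x)) - int (nat (- f x) + nat (- g x)))"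
    by (intro assms computable_int_diff computable_intros)
  moreover have "int (nat a + nat b) - int (nat (- a) + nat (- b)) = a + b" for a b
    by simp
  ultimately show ?thesis by simp
qed

lemma computable_mult_int [computable_intros]:
  fixes f g :: "'a::numbered \<Rightarrow> int"
  assumes "computable f" "computable g"
  shows "computable (\<lambda>x. f x * g x)"
proof -
  have "computable (\<lambda>x. int (nat (f x) * nat (g x) + nat (- f x) * nat (- g x)) -
      int (nat (f x) * nat (- g x) + nat (- f x) * nat (g x)))"
    by (intro assms computable_int_diff computable_intros)
  moreover have "int (nat a * nat b + nat (- a) * nat (- b)) -
      int (nat a * nat (- b) + nat (- a) * nat b) = a * b" for a b
    by (cases "a \<ge> 0"; cases "b \<ge> 0") auto
  ultimately show ?thesis by simp
qed

lemma computable_le_int [computable_intros]: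
  fixes f g :: "'a::numbered \<Rightarrow> int"
  assumes "computable f" "computable g"
  shows "computable (\<lambda>x. f x \<le> g x)"
proof -
  have "computable (\<lambda>x. nat (f x) + nat (- g x) \<le> nat (g x) + nat (- f x))"
    by (intro assms computable_intros)
  moreover have "nat a + nat (- b) \<le> nat b + nat (- a) \<longleftrightarrow> a \<le> b" for a b
    by linarith
  ultimately show ?thesis by simp
qed

lemma computable_eq_int [computable_intros]:
  fixes f g :: "'a::numbered \<Rightarrow> int"
  shows "computable f \<Longrightarrow> computable g \<Longrightarrow> computable (\<lambda>x. f x = g x)"
  using computable_conj[OF computable_le_int computable_le_int, of f g g f]
  by (simp add: eq_iff)

text \<open>On the right \<open>dec\<close> is taken at type \<open>int \<times> int\<close>: a code
  of a rational is a code of a fraction, so \<open>Fract\<close> acts as the identity on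
  codes.\<close>

lemma dec_rat_int_prod: "dec c = (case dec c of (a, b) \<Rightarrow> Fract a b)"
  by (simp add: dec_rat_def nat_to_rat_surj_def dec_prod_def dec_int_def Let_def split: prod.split)

lemma computable_Fract [computable_intros]:
  assumes "computable a" "computable b"
  shows "computable (\<lambda>x. Fract (a x) (b x))"
proof -
  obtain F where "recursive F" "\<And>c. dec (F c) = (a (dec c), b (dec c))"
    using computable_Pair[OF assms] unfolding computable_def by blast
  then show ?thesis
    by (intro computableI[of F]) (simp_all add: dec_rat_int_prod)
qed

text \<open>Codes with denominator \<open>0\<close> stand for \<open>0\<close>; replacing them by \<open>0 / 1\<close> is what allows \<open>b\<close> and \<open>d\<close> to
  be taken nonzero.\<close>

lemma computable_rat_binop:
  fixes f :: "rat \<Rightarrow> rat \<Rightarrow> 'b::numbered"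
  assumes K: "computable (\<lambda>y. K (fst (fst y)) (snd (fst y)) (fst (snd y)) (snd (snd y)))"
    and f: "\<And>a b c d. b \<noteq> 0 \<Longrightarrow> d \<noteq> 0 \<Longrightarrow> K a b c d = f (Fract a b) (Fract c d)"
    and "computable g" "computable h"
  shows "computable (\<lambda>x. f (g x) (h x))"
proof (rule computable_compose2[OF _ assms(3,4)])
  define N :: "int \<times> int \<Rightarrow> int \<times> int"
    where "N p = (if snd p = 0 then (0, 1) else p)" for p
  have N: "computable N"
    unfolding N_def by (intro computable_intros)
  have "computable (\<lambda>y. (N (fst y), N (snd y)))"
    by (intro computable_Pair computable_compose[OF N] computable_intros)
  from computable_compose[OF K this]
  have "computable (\<lambda>y. K (fst (N (fst y))) (snd (N (fst y))) (fst (N (snd y))) (snd (N (snd y))))"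
    by simp
  moreover have "K (fst (N p)) (snd (N p)) (fst (N q)) (snd (N q)) =
      f (Fract (fst p) (snd p)) (Fract (fst q) (snd q))" for p q
    by (subst f) (auto simp: N_def rat_number_collapse)
  ultimately have "computable (\<lambda>y. f (Fract (fst (fst y)) (snd (fst y))) (Fract (fst (snd y)) (snd (snd y))))"
    by simp
  then obtain F where F: "recursive F"
    "\<And>c. dec (F c) = (\<lambda>y. f (Fract (fst (fst y)) (snd (fst y))) (Fract (fst (snd y)) (snd (snd y)))) (dec c)"
    unfolding computable_def by blast
  show "computable (\<lambda>y. f (fst y) (snd y))"
  proof (rule computableI[OF F(1)])
    show "dec (F c) = f (fst (dec c :: rat \<times> rat)) (snd (dec c :: rat \<times> rat))" for c
      unfolding F(2) by (simp add: dec_prod_def[where 'a=rat] dec_prod_def[where 'a="int \<times> int"]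
          dec_rat_int_prod case_prod_beta)
  qed
qed

lemma computable_add_rat [computable_intros]:
  fixes f g :: "'a::numbered \<Rightarrow> rat"
  shows "computable f \<Longrightarrow> computable g \<Longrightarrow> computable (\<lambda>x. f x + g x)"
  by (rule computable_rat_binop[where K="\<lambda>a b c d. Fract (a * d + c * b) (b * d)"])
    (simp_all, intro computable_intros)

lemma computable_mult_rat [computable_intros]:
  fixes f g :: "'a::numbered \<Rightarrow> rat"
  shows "computable f \<Longrightarrow> computable g \<Longrightarrow> computable (\<lambda>x. f x * g x)"
  by (rule computable_rat_binop[where K="\<lambda>a b c d. Fract (a * c) (b * d)"])
    (simp_all, intro computable_intros)

text \<open>Denominators may be negative, so the inequality is multiplied by the positive number
  \<open>(b * d) * (b * d)\<close> instead of by \<open>b * d\<close>.\<close>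

lemma computable_le_rat [computable_intros]:
  fixes f g :: "'a::numbered \<Rightarrow> rat"
  shows "computable f \<Longrightarrow> computable g \<Longrightarrow> computable (\<lambda>x. f x \<le> g x)"
  by (rule computable_rat_binop[where K="\<lambda>a b c d. (a * d) * (b * d) \<le> (c * b) * (b * d)"])
    (simp_all, intro computable_intros)

lemma computable_less_rat [computable_intros]:
  fixes f g :: "'a::numbered \<Rightarrow> rat"
  shows "computable f \<Longrightarrow> computable g \<Longrightarrow> computable (\<lambda>x. f x < g x)"
  using computable_not[OF computable_le_rat, of g f] by (simp add: not_le)

lemma computable_diff_rat [computable_intros]:
  fixes f g :: "'a::numbered \<Rightarrow> rat"
  assumes "computable f" "computable g"
  shows "computable (\<lambda>x. f x - g x)"
proof -
  have "computable (\<lambda>x. f x + (- 1) * g x)"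
    by (intro assms computable_intros)
  then show ?thesis by simp
qed

lemma computable_of_nat_rat [computable_intros]:
  assumes "computable f"
  shows "computable (\<lambda>x. of_nat (f x) :: rat)"
proof -
  have "computable (\<lambda>x. Fract (int (f x)) 1)"
    by (intro assms computable_intros)
  then show ?thesis
    by (simp add: of_nat_rat)
qed

lemma computable_power2_rat [computable_intros]:
  assumes "computable n"
  shows "computable (\<lambda>x. 2 ^ n x :: rat)"
proof -
  have "computable (\<lambda>x. of_nat (2 ^ n x) :: rat)"
    by (intro assms computable_intros)
  then show ?thesis by simp
qed

lemma computable_divide_power2_rat [computable_intros]:
  fixes f :: "'a::numbered \<Rightarrow> rat"
  assumes "computable f" "computable n"
  shows "computable (\<lambda>x. f x / 2 ^ n x)"
proof -
  have "computable (\<lambda>x. f x * Fract 1 (int (2 ^ n x)))"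
    by (intro assms computable_intros)
  moreover have "Fract 1 (int (2 ^ k)) = 1 / 2 ^ k" for k
    by (simp add: Fract_of_int_quotient)
  ultimately show ?thesis by simp
qed

lemma computable_max_rat [computable_intros]:
  fixes f g :: "'a::numbered \<Rightarrow> rat"
  shows "computable f \<Longrightarrow> computable g \<Longrightarrow> computable (\<lambda>x. max (f x) (g x))"
  unfolding max_def by (intro computable_intros)

lemma computable_min_rat [computable_intros]:
  fixes f g :: "'a::numbered \<Rightarrow> rat"
  shows "computable f \<Longrightarrow> computable g \<Longrightarrow> computable (\<lambda>x. min (f x) (g x))"
  unfolding min_def by (intro computable_intros)

lemma computable_sum_rat [computable_intros]:
  fixes f :: "'a::numbered \<Rightarrow> nat \<Rightarrow> rat"
  assumes "computable (\<lambda>y. f (fst y) (snd y))" "computable n"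
  shows "computable (\<lambda>x. \<Sum>i<n x. f x i)"
proof -
  have "rec_nat 0 (\<lambda>i r. r + f x i) m = (\<Sum>i<m. f x i)" for x m
    by (induction m) auto
  moreover have "computable (\<lambda>x. rec_nat 0 (\<lambda>i r. r + f x i) (n x))"
    by (intro assms(2) computable_compose2[OF assms(1)] computable_intros)
  ultimately show ?thesis by simp
qed

lemma computable_sum_nat [computable_intros]:
  fixes f :: "'a::numbered \<Rightarrow> nat \<Rightarrow> nat"
  assumes "computable (\<lambda>y. f (fst y) (snd y))" "computable n"
  shows "computable (\<lambda>x. \<Sum>i<n x. f x i)"
proof -
  have "rec_nat 0 (\<lambda>i r. r + f x i) m = (\<Sum>i<m. f x i)" for x m
    by (induction m) auto
  moreover have "computable (\<lambda>x. rec_nat 0 (\<lambda>i r. r + f x i) (n x))"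
    by (intro assms(2) computable_compose2[OF assms(1)] computable_intros)
  ultimately show ?thesis by simp
qed

lemma computable_of_computable_rat_seq:
  assumes "computable_rat_seq q" shows "computable q"
proof -
  obtain e p where "\<And>\<alpha> n. eval \<alpha> p [n] = Some (e n)" "\<And>n. q n = nat_to_rat_surj (e n)"
    using assms unfolding computable_rat_seq_def computable_nat_def by blast
  then show ?thesis
    by (intro computableI[of e] recursiveI[of p]) (simp_all add: dec_rat_def dec_nat_def)
qed

section \<open>Clamped sequences and ramps\<close>

text \<open>The type is left open because the instance at \<open>rat\<close> is what gets computed
  and the instance at \<open>real\<close> is what gets estimated; \<open>of_rat_clamped\<close>
  links the two.\<close>

fun clamped :: "(nat \<Rightarrow> 'a \<Rightarrow> 'a::linordered_field) \<Rightarrow> nat \<Rightarrow> 'a \<Rightarrow> 'a" where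
  "clamped g 0 x = g 0 x"
| "clamped g (Suc n) x =
     max (clamped g n x - 1 / 2 ^ n) (min (g (Suc n) x) (clamped g n x + 1 / 2 ^ n))"

lemma computable_clamped [computable_intros]:
  fixes g :: "nat \<Rightarrow> rat \<Rightarrow> rat"
  assumes "computable (\<lambda>y. g (fst y) (snd y))" "computable n" "computable f"
  shows "computable (\<lambda>x. clamped g (n x) (f x))"
proof -
  have "rec_nat (g 0 q) (\<lambda>k r. max (r - 1 / 2 ^ k) (min (g (Suc k) q) (r + 1 / 2 ^ k))) m =
      clamped g m q" for m q
    by (induction m) auto
  moreover have "computable (\<lambda>x. rec_nat (g 0 (f x))
      (\<lambda>k r. max (r - 1 / 2 ^ k) (min (g (Suc k) (f x)) (r + 1 / 2 ^ k))) (n x))"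
    by (intro computable_compose2[OF assms(1)] computable_compose[OF assms(3)] assms(2,3)
        computable_intros)
  ultimately show ?thesis by simp
qed

lemma of_rat_max: "(of_rat (max a b) :: real) = max (of_rat a) (of_rat b)"
  by (simp add: max_def of_rat_less_eq)

lemma of_rat_min: "(of_rat (min a b) :: real) = min (of_rat a) (of_rat b)"
  by (simp add: min_def of_rat_less_eq)

lemma of_rat_clamped:
  assumes "\<And>n. (of_rat (g n q) :: real) = g' n (of_rat q)"
  shows "(of_rat (clamped g n q) :: real) = clamped g' n (of_rat q)"
  by (induction n) (simp_all add: assms of_rat_max of_rat_min of_rat_add of_rat_diff
      of_rat_divide of_rat_power)

lemma clamped_mono:
  fixes g :: "nat \<Rightarrow> real \<Rightarrow> real"
  assumes "\<And>n x y. x \<le> y \<Longrightarrow> g n x \<le> g n y" "x \<le> y"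
  shows "clamped g n x \<le> clamped g n y"
proof (induction n)
  case 0
  show ?case using assms by simp
next
  case (Suc n)
  then show ?case
    using assms(1)[OF assms(2), of "Suc n"] by (auto simp: max_def min_def)
qed

lemma clamped_step:
  fixes g :: "nat \<Rightarrow> real \<Rightarrow> real"
  shows "\<bar>clamped g (Suc n) x - clamped g n x\<bar> \<le> 1 / 2 ^ n"
  by (auto simp: max_def min_def abs_le_iff)

text \<open>Clamping is nonexpansive with respect to the maximum of the changes in its centre and in
  its value, so the constants combine by maximum. The sum bounds that maximum and is just as
  computable.\<close>

lemma clamped_lipschitz:
  fixes g :: "nat \<Rightarrow> real \<Rightarrow> real"
  assumes "\<And>n. \<bar>g n x - g n y\<bar> \<le> L n * \<bar>x - y\<bar>" "\<And>n. L n \<ge> 0"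
  shows "\<bar>clamped g n x - clamped g n y\<bar> \<le> (\<Sum>i<Suc n. L i) * \<bar>x - y\<bar>"
proof (induction n)
  case 0
  show ?case using assms(1)[of 0] by simp
next
  case (Suc n)
  have clamp: "\<bar>max (s - e) (min u (s + e)) - max (t - e) (min v (t + e))\<bar> \<le> max \<bar>s - t\<bar> \<bar>u - v\<bar>"
    if "e \<ge> 0" for s t u v e :: real
    using that by (auto simp: max_def min_def abs_if)
  have "\<bar>clamped g (Suc n) x - clamped g (Suc n) y\<bar> \<le>
      max \<bar>clamped g n x - clamped g n y\<bar> \<bar>g (Suc n) x - g (Suc n) y\<bar>"
    unfolding clamped.simps by (rule clamp) simp
  also have "\<dots> \<le> (\<Sum>i<Suc n. L i) * \<bar>x - y\<bar> + L (Suc n) * \<bar>x - y\<bar>"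
  proof (rule max.boundedI)
    have "0 \<le> L (Suc n) * \<bar>x - y\<bar>" "0 \<le> (\<Sum>i<Suc n. L i) * \<bar>x - y\<bar>"
      using assms(2) by (auto intro!: mult_nonneg_nonneg sum_nonneg simp del: sum.lessThan_Suc)
    then show "\<bar>clamped g n x - clamped g n y\<bar> \<le> (\<Sum>i<Suc n. L i) * \<bar>x - y\<bar> + L (Suc n) * \<bar>x - y\<bar>"
      "\<bar>g (Suc n) x - g (Suc n) y\<bar> \<le> (\<Sum>i<Suc n. L i) * \<bar>x - y\<bar> + L (Suc n) * \<bar>x - y\<bar>"
      using Suc assms(1)[of "Suc n"] by linarith+
  qed
  also have "\<dots> = (\<Sum>i<Suc (Suc n). L i) * \<bar>x - y\<bar>"
    by (simp add: algebra_simps)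
  finally show ?case .
qed

lemma clamped_approx:
  fixes g :: "nat \<Rightarrow> real \<Rightarrow> real"
  assumes "\<And>n. \<bar>g n x - y\<bar> \<le> 1 / 2 ^ n"
  shows "\<bar>clamped g n x - y\<bar> \<le> 1 / 2 ^ n"
proof (induction n)
  case 0
  show ?case using assms[of 0] by simp
next
  case (Suc n)
  \<comment> \<open>Clamping projects u to the interval from s - e to s + e. This interval contains
    y, so the projection does not move u away from y.\<close>
  have "\<bar>max (s - e) (min u (s + e)) - y\<bar> \<le> d"
    if "\<bar>s - y\<bar> \<le> e" "\<bar>u - y\<bar> \<le> d" for s u e d :: real
    using that by (auto simp: max_def min_def abs_if split: if_splits)
  from this[OF Suc assms[of "Suc n"]] show ?case
    unfolding clamped.simps .
qed

lemma clamped_limit: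
  fixes g :: "nat \<Rightarrow> real \<Rightarrow> real"
  shows "\<exists>w. \<forall>x. (\<lambda>n. clamped g n x) \<longlonglongrightarrow> w x \<and> (\<forall>n. \<bar>clamped g n x - w x\<bar> \<le> 2 / 2 ^ n)"
proof -
  \<comment> \<open>The right-hand side is the geometric sum of the steps \<open>1 / 2 ^ i\<close>
    for i from n to n + k - 1. It does not depend on x or on what g does there.\<close>
  have tail: "\<bar>clamped g (n + k) x - clamped g n x\<bar> \<le> 2 / 2 ^ n - 2 / 2 ^ (n + k)" for n k x
  proof (induction k)
    case (Suc k)
    then show ?case
      using clamped_step[of g "n + k" x] by (simp add: abs_le_iff)
  qed simp
  have "convergent (\<lambda>n. clamped g n x)" for x
  proof (rule Cauchy_convergent, rule CauchyI')
    fix e :: real assume "e > 0"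
    then obtain N where N: "(1 / 2) ^ N < e / 2"
      using real_arch_pow_inv[of "e / 2" "1 / 2"] by auto
    have "dist (clamped g m x) (clamped g n x) < e" if "m \<ge> N" "n > m" for m n
    proof -
      have "(1 / 2 :: real) ^ m \<le> (1 / 2) ^ N"
        using that by (intro power_decreasing) auto
      moreover have "\<bar>clamped g n x - clamped g m x\<bar> \<le> 2 / 2 ^ m"
        using tail[of m "n - m" x] that by (simp add: order_trans[of _ "2 / 2 ^ m - 2 / 2 ^ n"])
      ultimately show ?thesis
        using N by (simp add: dist_real_def power_one_over abs_minus_commute)
    qed
    then show "\<exists>M. \<forall>m\<ge>M. \<forall>n>m. dist (clamped g m x) (clamped g n x) < e"
      by blast
  qed
  then obtain w where w: "\<And>x. (\<lambda>n. clamped g n x) \<longlonglongrightarrow> w x"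
    unfolding convergent_def by metis
  have "\<bar>clamped g n x - w x\<bar> \<le> 2 / 2 ^ n" for n x
  proof (rule LIMSEQ_le_const2)
    show "(\<lambda>k. \<bar>clamped g n x - clamped g (k + n) x\<bar>) \<longlonglongrightarrow> \<bar>clamped g n x - w x\<bar>"
      by (intro tendsto_intros LIMSEQ_ignore_initial_segment w)
    have "\<bar>clamped g n x - clamped g (k + n) x\<bar> \<le> 2 / 2 ^ n" for k
      using tail[of n k x] by (simp add: abs_minus_commute add.commute
          order_trans[of _ "2 / 2 ^ n - 2 / 2 ^ (n + k)"])
    then show "\<exists>N. \<forall>k\<ge>N. \<bar>clamped g n x - clamped g (k + n) x\<bar> \<le> 2 / 2 ^ n"
      by blast
  qed
  with w show ?thesis by blast
qed

text \<open>The n-th output is some f m at a rational taken from the name. The Lipschitz bound is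
  required on the whole line because the rationals in a name of a point of S need not belong to
  S.\<close>

lemma computable_real_limit:
  assumes F: "computable (\<lambda>y. F (fst y) (snd y) :: rat)" and K: "computable (K :: nat \<Rightarrow> nat)"
    and f: "\<And>n q. real_of_rat (F n q) = f n (of_rat q)"
    and lip: "\<And>n x y. \<bar>f n x - f n y\<bar> \<le> real (K n) * \<bar>x - y\<bar>"
    and w: "\<And>n x. \<bar>f n x - w x\<bar> \<le> 2 / 2 ^ n"
  shows "computable_real (\<lambda>x. if x \<in> S then Some (w x) else None)"
proof -
  have "computable (\<lambda>y. F (fst y + 2) (dec (snd y)))"
    by (intro computable_compose2[OF F] computable_intros)
  then obtain R where R: "recursive R"
    "\<And>c. dec (R c) = (\<lambda>y. F (fst y + 2) (dec (snd y))) (dec c :: nat \<times> nat)"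
    unfolding computable_def by blast
  \<comment> \<open>As K (n + 2) is at most \<open>2 ^ K (n + 2)\<close>, an argument accurate to
    \<open>1 / 2 ^ k n\<close> costs at most \<open>1 / 2 ^ (n + 2)\<close> in f (n + 2), and the
    distance to the limit is at most \<open>2 / 2 ^ (n + 2)\<close>. Together this stays below
    \<open>1 / 2 ^ n\<close>.\<close>
  define k where "k n = n + 2 + K (n + 2)" for n
  have "recursive k"
    unfolding k_def[abs_def] computable_nat_iff[symmetric]
    by (intro computable_compose[OF K] computable_intros)
  then obtain pk pr pp where pk: "\<And>\<alpha> n. eval \<alpha> pk [n] = Some (k n)"
    and pr: "\<And>\<alpha> n. eval \<alpha> pr [n] = Some (R n)"
    and pp: "\<And>\<alpha> m n. eval \<alpha> pp [m, n] = Some (prod_encode (m, n))"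
    using R(1) recursive2_pair unfolding recursive_def recursive2_def by blast
  \<comment> \<open>\<open>recursive\<close> asks for the same value under every oracle, so its
    programs may be combined freely with \<open>Oracle\<close>. The name is queried once, at
    position k n.\<close>
  define p where "p = Cn pr [Cn pp [Proj 0, Cn Oracle [pk]]]"
  have p: "eval \<alpha> p [n] = Some (R (prod_encode (n, \<alpha> (k n))))" for \<alpha> n
    by (simp add: p_def pk pr pp)
  have "cauchy_name (\<lambda>n. R (prod_encode (n, \<alpha> (k n)))) (w x)" if "cauchy_name \<alpha> x" for \<alpha> x
    unfolding cauchy_name_def
  proof
    fix n
    define q where "q = nat_to_rat_surj (\<alpha> (k n))"
    have "dec (R (prod_encode (n, \<alpha> (k n)))) = F (n + 2) q"
      using R(2)[of "prod_encode (n, \<alpha> (k n))"]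
      by (simp add: dec_prod_def dec_nat_def dec_rat_def q_def)
    then have R': "real_of_rat (nat_to_rat_surj (R (prod_encode (n, \<alpha> (k n))))) = f (n + 2) (of_rat q)"
      by (simp add: dec_rat_def f)
    have "\<bar>x - of_rat q\<bar> \<le> 1 / 2 ^ k n"
      using that unfolding cauchy_name_def q_def by blast
    then have "real (K (n + 2)) * \<bar>x - of_rat q\<bar> \<le> 2 ^ K (n + 2) * (1 / 2 ^ k n)"
      by (intro mult_mono) (auto intro: less_imp_le of_nat_less_two_power)
    also have "\<dots> = 1 / 2 ^ n / 4"
      by (simp add: k_def power_add)
    finally have "\<bar>f (n + 2) x - f (n + 2) (of_rat q)\<bar> \<le> 1 / 2 ^ n / 4"
      using lip[of "n + 2" x "of_rat q"] by linarith
    moreover have "\<bar>f (n + 2) x - w x\<bar> \<le> 1 / 2 ^ n / 2"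
      using w[of "n + 2" x] by simp
    moreover have "(0 :: real) < 1 / 2 ^ n"
      by simp
    ultimately show "\<bar>w x - real_of_rat (nat_to_rat_surj (R (prod_encode (n, \<alpha> (k n)))))\<bar> \<le> 1 / 2 ^ n"
      unfolding R' by (simp only: abs_le_iff) linarith
  qed
  with p show ?thesis
    unfolding computable_real_def by (intro exI[of _ p]) (auto split: if_splits)
qed

text \<open>The ramp climbs from 0 to 1 on the l-th cell of width \<open>1 / 2 ^ N\<close>, counted
  from -1, and is constant on either side of it.\<close>

definition ramp :: "nat \<Rightarrow> nat \<Rightarrow> 'a::linordered_field \<Rightarrow> 'a" where
  "ramp N l x = max 0 (min 1 (2 ^ N * (x + 1) - of_nat l))"

lemma ramp_bounds: "0 \<le> ramp N l x" "ramp N l x \<le> 1"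
  by (auto simp: ramp_def)

lemma ramp_mono: "x \<le> y \<Longrightarrow> ramp N l x \<le> ramp N l y"
  unfolding ramp_def by (intro max.mono min.mono order_refl diff_right_mono mult_left_mono) auto

lemma ramp_lipschitz: "\<bar>ramp N l x - ramp N l y\<bar> \<le> 2 ^ N * \<bar>x - y\<bar>" for x y :: real
proof -
  have "\<bar>max 0 (min 1 s) - max 0 (min 1 t)\<bar> \<le> \<bar>s - t\<bar>" for s t :: real
    by (auto simp: max_def min_def)
  from this[of "2 ^ N * (x + 1) - real l" "2 ^ N * (y + 1) - real l"]
  have "\<bar>ramp N l x - ramp N l y\<bar> \<le> \<bar>2 ^ N * (x - y)\<bar>"
    unfolding ramp_def by (simp add: algebra_simps)
  then show ?thesis
    by (simp add: abs_mult)
qed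

lemma of_rat_ramp: "(of_rat (ramp N l q) :: real) = ramp N l (of_rat q)"
  by (simp add: ramp_def of_rat_max of_rat_min of_rat_add of_rat_diff of_rat_mult of_rat_power)

text \<open>The ramps with index below \<open>t\<close> contribute \<open>1\<close>, those above contribute \<open>0\<close>.\<close>

lemma sum_ramps_approx:
  fixes u :: "nat \<Rightarrow> real"
  assumes "\<And>i. 0 \<le> u i" "\<And>i. u i \<le> 1"
    and "\<And>i. i < K \<Longrightarrow> t \<le> real i \<Longrightarrow> u i = 0"
    and "\<And>i. i < K \<Longrightarrow> real i + 1 \<le> t \<Longrightarrow> u i = 1"
    and "0 \<le> t" "t < real K"
  shows "\<bar>(\<Sum>i<K. u i) - t\<bar> \<le> 1"
proof -
  \<comment> \<open>Only the ramp with index m is undetermined, so the sum lies between m and m + 1,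
    as t does.\<close>
  define m where "m = nat \<lfloor>t\<rfloor>"
  have m: "real m \<le> t" "t < real m + 1" "m < K"
    using assms(5,6) unfolding m_def by linarith+
  have "(\<Sum>i<K. u i) = (\<Sum>i<m. u i) + (\<Sum>i=m..<K. u i)"
    using m(3) by (simp add: lessThan_atLeast0 sum.atLeastLessThan_concat)
  also have "(\<Sum>i=m..<K. u i) = u m + (\<Sum>i=Suc m..<K. u i)"
    using m(3) by (rule sum.atLeast_Suc_lessThan)
  also have "(\<Sum>i<m. u i) = (\<Sum>i<m. 1)"
    using m by (intro sum.cong assms(4)) auto
  also have "(\<Sum>i=Suc m..<K. u i) = (\<Sum>i=Suc m..<K. 0)"
    using m by (intro sum.cong assms(3)) auto
  finally have "(\<Sum>i<K. u i) = real m + u m"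
    by simp
  with m assms(1,2)[of m] show ?thesis
    by linarith
qed

section \<open>Cuts\<close>

text \<open>This makes \<sigma> the beginning of a Cauchy name of every point between c and d at
  once, so that a single finite run of a program speaks about the whole interval.\<close>

definition fits :: "nat list \<Rightarrow> rat \<Rightarrow> rat \<Rightarrow> bool" where
  "fits \<sigma> c d \<longleftrightarrow> (\<forall>m<length \<sigma>. dec (\<sigma> ! m) - 1 / 2 ^ m \<le> c \<and> d \<le> dec (\<sigma> ! m) + 1 / 2 ^ m)"

lemma computable_fits [computable_intros]:
  assumes "computable s" "computable c" "computable d"
  shows "computable (\<lambda>x. fits (s x) (c x) (d x))"
  unfolding fits_def
  by (intro computable_compose[OF assms(2)] computable_compose[OF assms(3)] assms(1) computable_intros)

lemma fits_cauchy_name: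
  assumes "fits \<sigma> c d" "of_rat c \<le> x" "x \<le> of_rat d" "cauchy_name \<alpha> x"
  shows "cauchy_name (\<lambda>n. if n < length \<sigma> then \<sigma> ! n else \<alpha> n) x"
  unfolding cauchy_name_def
proof
  fix n
  show "\<bar>x - real_of_rat (nat_to_rat_surj (if n < length \<sigma> then \<sigma> ! n else \<alpha> n))\<bar> \<le> 1 / 2 ^ n"
  proof (cases "n < length \<sigma>")
    case True
    then have "nat_to_rat_surj (\<sigma> ! n) - 1 / 2 ^ n \<le> c" "d \<le> nat_to_rat_surj (\<sigma> ! n) + 1 / 2 ^ n"
      using assms(1) by (auto simp: fits_def dec_rat_def)
    then have "real_of_rat (nat_to_rat_surj (\<sigma> ! n) - 1 / 2 ^ n) \<le> of_rat c"
      "real_of_rat d \<le> of_rat (nat_to_rat_surj (\<sigma> ! n) + 1 / 2 ^ n)"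
      by (simp_all only: of_rat_less_eq)
    with assms(2,3) True show ?thesis
      by (simp add: of_rat_add of_rat_diff of_rat_divide of_rat_power abs_le_iff)
  qed (use assms(4) in \<open>simp add: cauchy_name_def\<close>)
qed

lemma ex_close_rat_code: "e > 0 \<Longrightarrow> \<exists>c. \<bar>x - real_of_rat (nat_to_rat_surj c)\<bar> < e"
proof -
  assume "e > 0"
  then obtain q where "x < of_rat q" "of_rat q < x + e"
    using of_rat_dense[of x "x + e"] by auto
  moreover obtain c where "q = nat_to_rat_surj c"
    using surj_nat_to_rat_surj by (metis surjD)
  ultimately show ?thesis
    by (intro exI[of _ c]) auto
qed

text \<open>A name that uses only half of the permitted error: the other half lets each of its
  prefixes serve a whole neighbourhood of x.\<close>

lemma ex_sharp_cauchy_name: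
  "\<exists>\<alpha>. cauchy_name \<alpha> x \<and> (\<forall>n. \<bar>x - real_of_rat (nat_to_rat_surj (\<alpha> n))\<bar> \<le> 1 / 2 ^ Suc n)"
proof -
  have "\<forall>n. \<exists>c. \<bar>x - real_of_rat (nat_to_rat_surj c)\<bar> < 1 / 2 ^ Suc n"
    by (intro allI ex_close_rat_code) simp
  then obtain \<alpha> where \<alpha>: "\<And>n. \<bar>x - real_of_rat (nat_to_rat_surj (\<alpha> n))\<bar> < 1 / 2 ^ Suc n"
    by metis
  have "(1 :: real) / 2 ^ Suc n \<le> 1 / 2 ^ n" for n
    by (simp add: field_simps)
  with \<alpha> have "cauchy_name \<alpha> x"
    unfolding cauchy_name_def by (meson less_imp_le order_trans)
  with \<alpha> show ?thesis
    by (meson less_imp_le)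
qed

text \<open>Entry m leaves a slack of \<open>1 / 2 ^ Suc m\<close>, which for m < L is at least
  \<open>1 / 2 ^ L\<close>.\<close>

lemma fits_prefix:
  assumes \<alpha>: "\<And>n. \<bar>x - real_of_rat (nat_to_rat_surj (\<alpha> n))\<bar> \<le> 1 / 2 ^ Suc n"
    and "x - 1 / 2 ^ L \<le> of_rat c" "of_rat d \<le> x + 1 / 2 ^ L"
  shows "fits (map \<alpha> [0..<L]) c d"
proof -
  have "dec (\<alpha> m) - 1 / 2 ^ m \<le> c \<and> d \<le> dec (\<alpha> m) + 1 / 2 ^ m" if "m < L" for m
  proof -
    have "(1 :: real) / 2 ^ L \<le> 1 / 2 ^ Suc m"
      using that by (intro divide_left_mono power_increasing) auto
    then have "real_of_rat (nat_to_rat_surj (\<alpha> m)) - 1 / 2 ^ m \<le> of_rat c \<and>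
        of_rat d \<le> real_of_rat (nat_to_rat_surj (\<alpha> m)) + 1 / 2 ^ m"
      using \<alpha>[of m] assms(2,3) by (simp add: abs_le_iff)
    then have "real_of_rat (dec (\<alpha> m) - 1 / 2 ^ m) \<le> of_rat c \<and>
        of_rat d \<le> real_of_rat (dec (\<alpha> m) + 1 / 2 ^ m)"
      by (simp add: dec_rat_def of_rat_add of_rat_diff of_rat_divide of_rat_power)
    then show ?thesis
      by (simp only: of_rat_less_eq)
  qed
  then show ?thesis
    by (simp add: fits_def)
qed

text \<open>The grid will be used on \<open>[-1, 2]\<close>: the margins around \<open>[0, 1]\<close> leave room for a cut to the
  left or to the right of the whole of \<open>C\<close>.\<close>

definition grid :: "nat \<Rightarrow> nat \<Rightarrow> rat" where
  "grid N j = of_nat j / 2 ^ N - 1"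

lemma of_rat_grid: "real_of_rat (grid N j) = real j / 2 ^ N - 1"
  by (simp add: grid_def of_rat_diff of_rat_divide of_rat_power)

lemma grid_cell:
  assumes "-1 \<le> x" "x < 2"
  obtains j where "j < 3 * 2 ^ N" "real_of_rat (grid N j) \<le> x" "x < of_rat (grid N (Suc j))"
proof
  let ?j = "nat \<lfloor>(x + 1) * 2 ^ N\<rfloor>"
  have j: "real ?j \<le> (x + 1) * 2 ^ N" "(x + 1) * 2 ^ N < real (Suc ?j)"
    using assms(1) by (auto simp: of_nat_nat) linarith
  then show "real_of_rat (grid N ?j) \<le> x" "x < of_rat (grid N (Suc ?j))"
    by (simp_all add: of_rat_grid field_simps)
  have "(x + 1) * 2 ^ N < 3 * 2 ^ N"
    using assms(2) by simp
  with j(1) have "real ?j < real (3 * 2 ^ N)"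
    unfolding of_nat_mult of_nat_power of_nat_numeral by (rule order.strict_trans1)
  then show "?j < 3 * 2 ^ N"
    by (simp only: of_nat_less_iff)
qed

lemma grid_mono: "i \<le> j \<Longrightarrow> real_of_rat (grid N i) \<le> of_rat (grid N j)"
  by (simp add: of_rat_grid divide_right_mono)

locale computable_monotone =
  fixes h :: "real \<rightharpoonup> real" and C :: "real set" and p :: recf and a b :: "nat \<Rightarrow> rat"
  assumes p: "\<And>x y \<alpha>. h x = Some y \<Longrightarrow> cauchy_name \<alpha> x \<Longrightarrow>
      \<exists>\<beta>. (\<forall>n. eval \<alpha> p [n] = Some (\<beta> n)) \<and> cauchy_name \<beta> y"
    and dom: "C \<subseteq> dom h"
    and unit: "C \<subseteq> {0..1}"
    and mono: "mono_on C (\<lambda>x. the (h x))"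
    and a: "computable a" and b: "computable b"
    and compl: "- C = (\<Union>i. {real_of_rat (a i) <..< real_of_rat (b i)})"
begin

section \<open>Finite computations of h near a point, and continuity\<close>

abbreviation H :: "real \<Rightarrow> real" where "H x \<equiv> the (h x)"

text \<open>Overwriting the beginning of any name of x by \<sigma> gives another name of x. On it p
  must produce a name of \<open>H x\<close>, and by soundness its k-th entry is v.\<close>

lemma feval_approx:
  assumes "x \<in> C" "fits \<sigma> c d" "of_rat c \<le> x" "x \<le> of_rat d" "feval \<sigma> p [k] = Some v"
  shows "\<bar>H x - of_rat (dec v)\<bar> \<le> 1 / 2 ^ k"
proof -
  obtain \<alpha> where "cauchy_name \<alpha> x"
    using ex_sharp_cauchy_name by blast
  define \<alpha>' where "\<alpha>' n = (if n < length \<sigma> then \<sigma> ! n else \<alpha> n)" for n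
  have "cauchy_name \<alpha>' x"
    unfolding \<alpha>'_def using assms(2-4) \<open>cauchy_name \<alpha> x\<close> by (rule fits_cauchy_name)
  moreover have "h x = Some (H x)"
    using assms(1) dom by auto
  ultimately obtain \<beta> where \<beta>: "\<And>n. eval \<alpha>' p [n] = Some (\<beta> n)" "cauchy_name \<beta> (H x)"
    using p by blast
  have "eval \<alpha>' p [k] = Some v"
    using assms(5) by (rule feval_sound[rotated]) (simp add: \<alpha>'_def)
  with \<beta>(1)[of k] have "\<beta> k = v"
    by simp
  with \<beta>(2) show ?thesis
    by (auto simp: cauchy_name_def dec_rat_def)
qed

text \<open>The run of p on a sharp name of x uses only a prefix, and that prefix fits every
  interval close to x. The third property feeds the certificates, the fourth gives
  continuity.\<close>

lemma feval_near:
  assumes "x \<in> C"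
  obtains \<sigma> v \<delta> where "\<delta> > 0" "feval \<sigma> p [k] = Some v"
    "\<And>c d. x - \<delta> \<le> of_rat c \<Longrightarrow> of_rat d \<le> x + \<delta> \<Longrightarrow> fits \<sigma> c d"
    "\<And>y. y \<in> C \<Longrightarrow> \<bar>y - x\<bar> < \<delta> \<Longrightarrow> \<bar>H y - of_rat (dec v)\<bar> \<le> 1 / 2 ^ k"
proof -
  obtain \<alpha> where \<alpha>: "cauchy_name \<alpha> x"
    "\<And>n. \<bar>x - real_of_rat (nat_to_rat_surj (\<alpha> n))\<bar> \<le> 1 / 2 ^ Suc n"
    using ex_sharp_cauchy_name by blast
  have "h x = Some (H x)"
    using assms dom by auto
  then obtain v where "eval \<alpha> p [k] = Some v"
    using p \<alpha>(1) by blast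
  then obtain L where L: "feval (map \<alpha> [0..<L]) p [k] = Some v"
    using feval_complete by blast
  let ?\<delta> = "1 / 2 ^ L :: real"
  have fits: "fits (map \<alpha> [0..<L]) c d" if "x - ?\<delta> \<le> of_rat c" "of_rat d \<le> x + ?\<delta>" for c d
    using \<alpha>(2) that by (rule fits_prefix)
  show thesis
  proof (rule that[OF _ L fits])
    fix y assume y: "y \<in> C" "\<bar>y - x\<bar> < ?\<delta>"
    obtain c where c: "x - ?\<delta> < of_rat c" "of_rat c < y"
      using of_rat_dense[of "x - ?\<delta>" y] y(2) by (auto simp: abs_less_iff)
    obtain d where d: "y < of_rat d" "of_rat d < x + ?\<delta>"
      using of_rat_dense[of y "x + ?\<delta>"] y(2) by (auto simp: abs_less_iff)
    show "\<bar>H y - of_rat (dec v)\<bar> \<le> 1 / 2 ^ k"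
      using y(1) fits[of c d] c d L by (intro feval_approx[of y _ c d]) auto
  qed auto
qed

lemma continuous: "continuous_on C H"
  unfolding continuous_on_iff
proof (intro ballI allI impI)
  fix x and e :: real assume "x \<in> C" "e > 0"
  obtain k where k: "(1 / 2) ^ k < e / 2"
    using real_arch_pow_inv[of "e / 2" "1 / 2"] \<open>e > 0\<close> by auto
  obtain v \<delta> where \<delta>: "\<delta> > 0"
    "\<And>y. y \<in> C \<Longrightarrow> \<bar>y - x\<bar> < \<delta> \<Longrightarrow> \<bar>H y - of_rat (dec v)\<bar> \<le> 1 / 2 ^ k"
    using feval_near[OF \<open>x \<in> C\<close>] by metis
  have "dist (H y) (H x) < e" if "y \<in> C" "dist y x < \<delta>" for y
    using \<delta>(2)[of y] \<delta>(2)[of x] \<delta>(1) \<open>x \<in> C\<close> that k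
    by (simp add: dist_real_def power_one_over abs_le_iff abs_less_iff)
  with \<delta>(1) show "\<exists>d>0. \<forall>y\<in>C. dist y x < d \<longrightarrow> dist (H y) (H x) < e"
    by blast
qed

lemma compact: "compact C"
proof -
  have "closed C"
    using compl by (simp add: closed_def open_UN)
  moreover have "bounded C"
    using unit bounded_closed_interval bounded_subset by blast
  ultimately show ?thesis
    by (simp add: compact_eq_bounded_closed)
qed

text \<open>The number t serves as a certificate in either of two readings: as the index of an
  interval off C, or as the code of a prefix on which p halts. The margin \<open>1 / 2 ^ k\<close>
  absorbs the error of the output. R and L are flags for the two required bounds, q < H and H < q',
  and not comparisons of indices, so that they can also be set by a real point before a grid is
  chosen.\<close>

definition accepts :: "rat \<Rightarrow> rat \<Rightarrow> nat \<Rightarrow> bool \<Rightarrow> bool \<Rightarrow> rat \<Rightarrow> rat \<Rightarrow> nat \<Rightarrow> bool" where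
  "accepts q q' k R L c d t \<longleftrightarrow> (a t < c \<and> d < b t) \<or>
     (fits (dec t) c d \<and> (case feval (dec t) p [k] of None \<Rightarrow> False
        | Some v \<Rightarrow> (R \<longrightarrow> q + 1 / 2 ^ k < dec v) \<and> (L \<longrightarrow> dec v < q' - 1 / 2 ^ k)))"

text \<open>The cell \<open>l\<close> is certified to lie to the right of \<open>{x \<in> C. H x \<le> q}\<close> and to the left of
  \<open>{x \<in> C. q' \<le> H x}\<close>.\<close>

definition cut :: "rat \<Rightarrow> rat \<Rightarrow> nat \<Rightarrow> nat \<Rightarrow> nat \<Rightarrow> bool" where
  "cut q q' k N l \<longleftrightarrow>
     (\<forall>j<3 * 2 ^ N. \<exists>t<N. accepts q q' k (l \<le> j) (j \<le> l) (grid N j) (grid N (Suc j)) t)"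

lemma computable_cut [computable_intros]:
  assumes "computable q" "computable q'" "computable k" "computable N" "computable l"
  shows "computable (\<lambda>x. cut (q x) (q' x) (k x) (N x) (l x))"
  unfolding cut_def accepts_def grid_def
  by (intro computable_compose[OF assms(1)] computable_compose[OF assms(2)]
      computable_compose[OF assms(3)] computable_compose[OF assms(4)]
      computable_compose[OF assms(5)] computable_compose[OF a] computable_compose[OF b] computable_intros)

text \<open>The certificates give q < H on C from cell l onwards and H < q' on C up to and including
  cell l. Points with H x \<le> q thus fall in cells before l, where the ramp is 0, and points with
  H x \<ge> q' in cells after l, where it is 1.\<close>

lemma cut_sound:
  assumes "cut q q' k N l" "x \<in> C"
  shows "H x \<le> of_rat q \<Longrightarrow> ramp N l x = 0" "of_rat q' \<le> H x \<Longrightarrow> ramp N l x = 1"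
proof -
  have "-1 \<le> x" "x < 2"
    using assms(2) unit by force+
  then obtain j where j: "j < 3 * 2 ^ N" "real_of_rat (grid N j) \<le> x" "x < of_rat (grid N (Suc j))"
    by (rule grid_cell)
  obtain t where "t < N" and t: "accepts q q' k (l \<le> j) (j \<le> l) (grid N j) (grid N (Suc j)) t"
    using assms(1) j(1) unfolding cut_def by blast
  have "\<not> (a t < grid N j \<and> grid N (Suc j) < b t)"
  proof
    assume "a t < grid N j \<and> grid N (Suc j) < b t"
    then have "real_of_rat (a t) < of_rat (grid N j)" "real_of_rat (grid N (Suc j)) < of_rat (b t)"
      by (simp_all only: of_rat_less)
    with j have "x \<in> {real_of_rat (a t) <..< real_of_rat (b t)}"
      by simp
    then have "x \<in> - C"
      unfolding compl by blast
    with assms(2) show False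
      by simp
  qed
  then obtain v where v: "fits (dec t) (grid N j) (grid N (Suc j))" "feval (dec t) p [k] = Some v"
    "l \<le> j \<Longrightarrow> q + 1 / 2 ^ k < dec v" "j \<le> l \<Longrightarrow> dec v < q' - 1 / 2 ^ k"
    using t unfolding accepts_def by (auto split: option.splits)
  have Hx: "\<bar>H x - of_rat (dec v)\<bar> \<le> 1 / 2 ^ k"
    using assms(2) v(1,2) j(2,3) by (intro feval_approx) auto
  have x: "real j \<le> 2 ^ N * (x + 1)" "2 ^ N * (x + 1) < real (Suc j)"
    using j(2,3) by (simp_all add: of_rat_grid field_simps)
  {
    assume "H x \<le> of_rat q"
    have "\<not> l \<le> j"
    proof
      assume "l \<le> j"
      then have "real_of_rat (q + 1 / 2 ^ k) < of_rat (dec v)"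
        using v(3) by (simp only: of_rat_less)
      with Hx \<open>H x \<le> of_rat q\<close> show False
        by (simp add: of_rat_add of_rat_divide of_rat_power abs_le_iff)
    qed
    then have "real (Suc j) \<le> real l"
      by simp
    with x show "ramp N l x = 0"
      by (simp add: ramp_def)
  }
  {
    assume "of_rat q' \<le> H x"
    have "\<not> j \<le> l"
    proof
      assume "j \<le> l"
      then have "real_of_rat (dec v) < of_rat (q' - 1 / 2 ^ k)"
        using v(4) by (simp only: of_rat_less)
      with Hx \<open>of_rat q' \<le> H x\<close> show False
        by (simp add: of_rat_diff of_rat_divide of_rat_power abs_le_iff)
    qed
    then have "real l + 1 \<le> real j"
      by simp
    with x show "ramp N l x = 1"
      by (simp add: ramp_def)
  }
qed

lemma cut_point:
  assumes "q1 < q2"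
  obtains u where "-1 \<le> u" "u < 2" "\<And>x. x \<in> C \<Longrightarrow> H x \<le> q1 \<Longrightarrow> x < u"
    "\<And>x. x \<in> C \<Longrightarrow> q2 \<le> H x \<Longrightarrow> u < x"
proof -
  \<comment> \<open>The extra points -1/2 and 3/2 keep both sets nonempty and lie beyond C on the
    proper sides, so u stays within the grid. Since the sets are closed, supremum and infimum are
    attained, and monotonicity makes their order strict.\<close>
  define A where "A = insert (- 1 / 2) {x \<in> C. H x \<le> q1}"
  define B where "B = insert (3 / 2) {x \<in> C. q2 \<le> H x}"
  have closed: "closed C"
    using compact by (rule compact_imp_closed)
  have "{x \<in> C. H x \<le> q1} = C \<inter> H -` {..q1}" "{x \<in> C. q2 \<le> H x} = C \<inter> H -` {q2..}"
    by auto
  then have "closed A" "closed B"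
    unfolding A_def B_def
    by (auto intro!: closed_insert continuous_closed_preimage[OF continuous closed])
  moreover have "A \<noteq> {}" "B \<noteq> {}"
    by (simp_all add: A_def B_def)
  moreover have A: "\<And>x. x \<in> A \<Longrightarrow> - 1 / 2 \<le> x \<and> x \<le> 1" and B: "\<And>x. x \<in> B \<Longrightarrow> 0 \<le> x \<and> x \<le> 3 / 2"
    using unit by (force simp: A_def B_def)+
  then have bdd: "bdd_above A" "bdd_below B"
    by (meson bdd_aboveI bdd_belowI)+
  ultimately have mem: "Sup A \<in> A" "Inf B \<in> B"
    by (auto intro: closed_contains_Sup closed_contains_Inf)
  have "x < y" if "x \<in> A" "y \<in> B" for x y
  proof (rule ccontr)
    assume "\<not> x < y"
    with that A[of x] B[of y] have "x \<in> C" "y \<in> C" "H x \<le> q1" "q2 \<le> H y" "y \<le> x"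
      by (auto simp: A_def B_def)
    then have "q2 \<le> q1"
      using mono_onD[OF mono, of y x] by linarith
    with assms show False
      by simp
  qed
  with mem have "Sup A < Inf B"
    by blast
  define u where "u = (Sup A + Inf B) / 2"
  have u: "Sup A < u" "u < Inf B"
    using \<open>Sup A < Inf B\<close> by (simp_all add: u_def)
  show thesis
  proof
    show "-1 \<le> u" "u < 2"
      using u A[OF mem(1)] B[OF mem(2)] by linarith+
    show "x < u" if "x \<in> C" "H x \<le> q1" for x
      using that u(1) cSup_upper[OF _ bdd(1), of x] by (simp add: A_def)
    show "u < x" if "x \<in> C" "q2 \<le> H x" for x
      using that u(2) cInf_lower[OF _ bdd(2), of x] by (simp add: B_def)
  qed
qed

text \<open>This is the local half of a compactness argument: one certificate t works for all small
  intervals around x. Of the margin \<open>2 / 2 ^ k\<close>, one half pays for the error of v and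
  the other is the margin that \<open>accepts\<close> demands.\<close>

lemma accepts_near:
  fixes x u :: real
  assumes u: "\<And>x. x \<in> C \<Longrightarrow> H x \<le> of_rat q + 2 / 2 ^ k \<Longrightarrow> x < u"
    "\<And>x. x \<in> C \<Longrightarrow> of_rat q' - 2 / 2 ^ k \<le> H x \<Longrightarrow> u < x"
  shows "\<exists>t. \<exists>\<delta>>0. \<forall>c d. x - \<delta> \<le> of_rat c \<longrightarrow> of_rat d \<le> x + \<delta> \<longrightarrow>
      accepts q q' k (u \<le> of_rat d) (of_rat c \<le> u) c d t"
proof (cases "x \<in> C")
  case False
  then have "x \<in> (\<Union>i. {real_of_rat (a i) <..< real_of_rat (b i)})"
    using compl by blast
  then obtain t where t: "of_rat (a t) < x" "x < of_rat (b t)"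
    by auto
  define \<delta> where "\<delta> = min (x - of_rat (a t)) (of_rat (b t) - x) / 2"
  have \<delta>: "\<delta> > 0" "\<delta> < x - of_rat (a t)" "\<delta> < of_rat (b t) - x"
    using t by (auto simp: \<delta>_def min_def)
  have "accepts q q' k (u \<le> of_rat d) (of_rat c \<le> u) c d t"
    if "x - \<delta> \<le> of_rat c" "of_rat d \<le> x + \<delta>" for c d
  proof -
    have "real_of_rat (a t) < of_rat c" "real_of_rat d < of_rat (b t)"
      using that \<delta> by linarith+
    then show ?thesis
      by (simp add: accepts_def of_rat_less)
  qed
  with \<delta>(1) show ?thesis
    by blast
next
  case True
  obtain \<sigma> v \<delta> where \<delta>: "\<delta> > 0" "feval \<sigma> p [k] = Some v"
    "\<And>c d. x - \<delta> \<le> of_rat c \<Longrightarrow> of_rat d \<le> x + \<delta> \<Longrightarrow> fits \<sigma> c d"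
    "\<And>y. y \<in> C \<Longrightarrow> \<bar>y - x\<bar> < \<delta> \<Longrightarrow> \<bar>H y - of_rat (dec v)\<bar> \<le> 1 / 2 ^ k"
    by (rule feval_near[OF True, of k]) blast
  obtain t where t: "dec t = \<sigma>"
    using surj_dec by (metis surjD)
  \<comment> \<open>If x differs from u, the interval is kept clear of u, and only the flag for the
    side of x can be raised. If x = u, both may be raised, but then x is neither left nor right of u
    and \<open>H x\<close> obeys both bounds.\<close>
  define \<delta>' where "\<delta>' = (if x = u then \<delta> else min \<delta> (\<bar>x - u\<bar> / 2))"
  have \<delta>': "\<delta>' > 0" "\<delta>' \<le> \<delta>" "x \<noteq> u \<Longrightarrow> \<delta>' < \<bar>x - u\<bar>"
    using \<delta>(1) by (auto simp: \<delta>'_def min_def)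
  have v: "\<bar>H x - of_rat (dec v)\<bar> \<le> 1 / 2 ^ k"
    using \<delta>(1,4) True by simp
  have "accepts q q' k (u \<le> of_rat d) (of_rat c \<le> u) c d t"
    if cd: "x - \<delta>' \<le> of_rat c" "of_rat d \<le> x + \<delta>'" for c d
  proof -
    have "fits \<sigma> c d"
      using \<delta>'(2) cd by (intro \<delta>(3)) linarith+
    moreover have "q + 1 / 2 ^ k < dec v" if "u \<le> of_rat d"
    proof -
      have "\<not> x < u"
        using \<delta>'(3) cd(2) that by auto
      then have "of_rat q + 2 / 2 ^ k < H x"
        using u(1)[OF True] by linarith
      with v have "real_of_rat (q + 1 / 2 ^ k) < of_rat (dec v)"
        by (simp add: of_rat_add of_rat_divide of_rat_power abs_le_iff)
      then show ?thesis
        by (simp only: of_rat_less)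
    qed
    moreover have "dec v < q' - 1 / 2 ^ k" if "of_rat c \<le> u"
    proof -
      have "\<not> u < x"
        using \<delta>'(3) cd(1) that by auto
      then have "H x < of_rat q' - 2 / 2 ^ k"
        using u(2)[OF True] by linarith
      with v have "real_of_rat (dec v) < of_rat (q' - 1 / 2 ^ k)"
        by (simp add: of_rat_diff of_rat_divide of_rat_power abs_le_iff)
      then show ?thesis
        by (simp only: of_rat_less)
    qed
    ultimately show ?thesis
      by (simp add: accepts_def t \<delta>(2))
  qed
  with \<delta>'(1) show ?thesis
    by blast
qed

text \<open>The distance \<open>4 / 2 ^ k\<close> pays for a margin of \<open>2 / 2 ^ k\<close> at
  each of the two levels and still leaves them strictly ordered, so that a separating point
  exists.\<close>

lemma cut_exists:
  assumes "q + 4 / 2 ^ k < q'"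
  shows "\<exists>N l. cut q q' k N l"
proof -
  have "real_of_rat (q + 4 / 2 ^ k) < of_rat q'"
    using assms by (simp only: of_rat_less)
  then have "real_of_rat q + 2 / 2 ^ k < of_rat q' - 2 / 2 ^ k"
    by (simp add: of_rat_add of_rat_divide of_rat_power)
  then obtain u where u: "-1 \<le> u" "u < 2" "\<And>x. x \<in> C \<Longrightarrow> H x \<le> of_rat q + 2 / 2 ^ k \<Longrightarrow> x < u"
    "\<And>x. x \<in> C \<Longrightarrow> of_rat q' - 2 / 2 ^ k \<le> H x \<Longrightarrow> u < x"
    by (rule cut_point) blast
  let ?ok = "\<lambda>N j t. accepts q q' k (u \<le> of_rat (grid N (Suc j))) (of_rat (grid N j) \<le> u)
      (grid N j) (grid N (Suc j)) t"
  \<comment> \<open>From some N on, every cell meeting the interval has a certificate below N.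
    Asking this of all large N lets two adjacent intervals agree on one N, which is both the
    resolution of the grid and the bound on certificates.\<close>
  let ?P = "\<lambda>(c :: real) (d :: real). \<exists>N0. \<forall>N\<ge>N0. \<forall>j. of_rat (grid N j) \<le> d \<longrightarrow> c \<le> of_rat (grid N (Suc j)) \<longrightarrow>
      (\<exists>t<N. ?ok N j t)"
  have "?P (-1) 2"
  proof (rule Bolzano[where P="?P"])
    fix c d e :: real assume "c \<le> d" "d \<le> e"
    assume "?P c d" then obtain N1 where N1: "\<forall>N\<ge>N1. \<forall>j. of_rat (grid N j) \<le> d \<longrightarrow>
        c \<le> of_rat (grid N (Suc j)) \<longrightarrow> (\<exists>t<N. ?ok N j t)" by blast
    assume "?P d e" then obtain N2 where N2: "\<forall>N\<ge>N2. \<forall>j. of_rat (grid N j) \<le> e \<longrightarrow>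
        d \<le> of_rat (grid N (Suc j)) \<longrightarrow> (\<exists>t<N. ?ok N j t)" by blast
    have "\<exists>t<N. ?ok N j t" if "N \<ge> max N1 N2" "of_rat (grid N j) \<le> e"
      "c \<le> of_rat (grid N (Suc j))" for N j
    proof (cases "of_rat (grid N j) \<le> d")
      case True
      with N1 that show ?thesis by simp
    next
      case False
      then have "d \<le> of_rat (grid N (Suc j))"
        using grid_mono[of j "Suc j" N] by simp
      with N2 that show ?thesis by simp
    qed
    then show "?P c e" by blast
  next
    fix x :: real
    obtain t \<delta> where \<delta>: "\<delta> > 0" and t: "\<And>c d. x - \<delta> \<le> of_rat c \<Longrightarrow> of_rat d \<le> x + \<delta> \<Longrightarrow>
        accepts q q' k (u \<le> of_rat d) (of_rat c \<le> u) c d t"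
      using accepts_near[OF u(3,4), where x = x] by blast
    \<comment> \<open>A cell narrower than \<delta>/2 that meets an interval around x of length
      below \<delta>/2 stays within \<delta> of x, so the single t serves all such cells.\<close>
    obtain N1 where N1: "(1 / 2) ^ N1 < \<delta> / 2"
      using real_arch_pow_inv[of "\<delta> / 2" "1 / 2"] \<delta> by auto
    have "?P c d" if cd: "c \<le> x" "x \<le> d" "d - c < \<delta> / 2" for c d
    proof -
      have "?ok N j t"
        if "N \<ge> max N1 (Suc t)" "of_rat (grid N j) \<le> d" "c \<le> of_rat (grid N (Suc j))" for N j
      proof -
        have "(1 / 2 :: real) ^ N \<le> (1 / 2) ^ N1"
          using that(1) by (intro power_decreasing) auto
        then have "real_of_rat (grid N (Suc j)) - of_rat (grid N j) < \<delta> / 2"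
          using N1 by (simp add: of_rat_grid add_divide_distrib power_one_over)
        with that cd show ?thesis
          by (intro t) linarith+
      qed
      then show ?thesis
        by (intro exI[of _ "max N1 (Suc t)"]) (auto simp: Suc_le_eq)
    qed
    with \<delta> show "\<exists>r>0. \<forall>c d. c \<le> x \<and> x \<le> d \<and> d - c < r \<longrightarrow> ?P c d"
      by (intro exI[of _ "\<delta> / 2"]) simp
  qed simp
  then obtain N where N: "\<And>j. of_rat (grid N j) \<le> (2 :: real) \<Longrightarrow> -1 \<le> real_of_rat (grid N (Suc j)) \<Longrightarrow>
      \<exists>t<N. ?ok N j t"
    by blast
  obtain l where l: "real_of_rat (grid N l) \<le> u" "u < of_rat (grid N (Suc l))"
    using grid_cell[OF u(1,2)] by blast
  have "\<exists>t<N. accepts q q' k (l \<le> j) (j \<le> l) (grid N j) (grid N (Suc j)) t"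
    if "j < 3 * 2 ^ N" for j
  proof -
    have "real j < real (3 * 2 ^ N)"
      using that by (simp only: of_nat_less_iff)
    then have "real_of_rat (grid N j) \<le> 2" "-1 \<le> real_of_rat (grid N (Suc j))"
      by (simp_all add: of_rat_grid field_simps)
    then obtain t where t: "t < N" "?ok N j t"
      using N by blast
    \<comment> \<open>As u lies in cell l, every flag raised by comparing j with l is also raised by
      comparing cell j with u, and \<open>accepts\<close> only gets weaker when flags are
      lowered.\<close>
    have "u \<le> of_rat (grid N (Suc j))" if "l \<le> j"
      using grid_mono[of "Suc l" "Suc j" N] that l by simp
    moreover have "of_rat (grid N j) \<le> u" if "j \<le> l"
      using grid_mono[of j l N] that l by simp
    ultimately show ?thesis
      using t unfolding accepts_def by (auto split: option.splits)
  qed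
  then show ?thesis
    unfolding cut_def by blast
qed

section \<open>Monotone approximations from cuts at equidistant levels\<close>

definition level :: "nat \<Rightarrow> nat \<Rightarrow> nat \<Rightarrow> rat" where
  "level M n i = of_nat i / 2 ^ n - of_nat M"

text \<open>The search runs over codes of pairs of resolution and cell. It is effective because the
  resolution also bounds the certificates, which makes \<open>cut\<close> decidable.\<close>

definition found :: "nat \<Rightarrow> nat \<Rightarrow> nat \<Rightarrow> nat \<times> nat" where
  "found M n i = dec (LEAST z. cut (level M n i) (level M n (Suc i)) (n + 3)
     (fst (dec z :: nat \<times> nat)) (snd (dec z :: nat \<times> nat)))"

lemma cut_code_exists:
  "\<exists>z. cut (level M n i) (level M n (Suc i)) (n + 3) (fst (dec z :: nat \<times> nat)) (snd (dec z :: nat \<times> nat))"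
proof -
  \<comment> \<open>Neighbouring levels are \<open>1 / 2 ^ n\<close> apart, and
    \<open>4 / 2 ^ (n + 3)\<close> is half of that.\<close>
  have "level M n i + 4 / 2 ^ (n + 3) < level M n (Suc i)"
    by (simp add: level_def power_add field_simps)
  then obtain N l where "cut (level M n i) (level M n (Suc i)) (n + 3) N l"
    using cut_exists by blast
  moreover obtain z where "dec z = (N, l)"
    using surj_dec by (metis surjD)
  ultimately show ?thesis
    by (intro exI[of _ z]) simp
qed

lemma cut_found: "cut (level M n i) (level M n (Suc i)) (n + 3) (fst (found M n i)) (snd (found M n i))"
  unfolding found_def by (rule LeastI_ex[OF cut_code_exists])

lemma computable_level [computable_intros]:
  assumes "computable n" "computable i"
  shows "computable (\<lambda>x. level M (n x) (i x))"
  unfolding level_def by (intro assms computable_intros)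

lemma computable_found [computable_intros]:
  assumes "computable n" "computable i"
  shows "computable (\<lambda>x. found M (n x) (i x))"
proof (rule computable_compose2[OF _ assms])
  show "computable (\<lambda>y. found M (fst y) (snd y))"
    unfolding found_def
  proof (intro computable_decode computable_Least)
    show "computable (\<lambda>y :: (nat \<times> nat) \<times> nat. cut (level M (fst (fst y)) (snd (fst y)))
        (level M (fst (fst y)) (Suc (snd (fst y)))) (fst (fst y) + 3)
        (fst (dec (snd y) :: nat \<times> nat)) (snd (dec (snd y) :: nat \<times> nat)))"
      by (intro computable_intros)
  qed (rule cut_code_exists)
qed

text \<open>There are \<open>2 * M * 2 ^ n\<close> levels from -M up to M in steps of
  \<open>1 / 2 ^ n\<close>; each ramp that has been climbed raises the value by one step above
  -M.\<close>

definition stair :: "nat \<Rightarrow> nat \<Rightarrow> 'a \<Rightarrow> 'a::linordered_field" where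
  "stair M n x = (\<Sum>i<2 * M * 2 ^ n. ramp (fst (found M n i)) (snd (found M n i)) x) / 2 ^ n - of_nat M"

lemma computable_stair [computable_intros]:
  assumes "computable n" "computable x"
  shows "computable (\<lambda>y. stair M (n y) (x y) :: rat)"
  unfolding stair_def ramp_def
  by (intro computable_compose[OF assms(1)] computable_compose[OF assms(2)] assms computable_intros)

lemma of_rat_stair: "(of_rat (stair M n q) :: real) = stair M n (of_rat q)"
  by (simp add: stair_def of_rat_diff of_rat_divide of_rat_power of_rat_sum of_rat_ramp)

lemma stair_mono: "x \<le> y \<Longrightarrow> stair M n x \<le> stair M n y"
  unfolding stair_def by (intro diff_right_mono divide_right_mono sum_mono ramp_mono) auto

lemma stair_lipschitz:
  fixes x y :: real
  shows "\<bar>stair M n x - stair M n y\<bar> \<le> real (\<Sum>i<2 * M * 2 ^ n. 2 ^ fst (found M n i)) * \<bar>x - y\<bar>"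
proof -
  let ?r = "\<lambda>i. ramp (fst (found M n i)) (snd (found M n i))"
  have "\<bar>stair M n x - stair M n y\<bar> = \<bar>\<Sum>i<2 * M * 2 ^ n. ?r i x - ?r i y\<bar> / 2 ^ n"
    by (simp add: stair_def sum_subtractf abs_divide flip: diff_divide_distrib)
  \<comment> \<open>The factor \<open>1 / 2 ^ n\<close> is given away so that the Lipschitz constant
    is a natural number, the form that \<open>computable_real_limit\<close> takes.\<close>
  also have "\<dots> \<le> \<bar>\<Sum>i<2 * M * 2 ^ n. ?r i x - ?r i y\<bar>"
    by (simp add: divide_le_eq mult_le_cancel_left1)
  also have "\<dots> \<le> (\<Sum>i<2 * M * 2 ^ n. 2 ^ fst (found M n i) * \<bar>x - y\<bar>)"
    by (intro order_trans[OF sum_abs] sum_mono ramp_lipschitz)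
  also have "\<dots> = real (\<Sum>i<2 * M * 2 ^ n. 2 ^ fst (found M n i)) * \<bar>x - y\<bar>"
    by (simp add: sum_distrib_right)
  finally show ?thesis .
qed

lemma stair_approx:
  assumes "x \<in> C" "\<bar>H x\<bar> < real M"
  shows "\<bar>stair M n x - H x\<bar> \<le> 1 / 2 ^ n"
proof -
  let ?u = "\<lambda>i. ramp (fst (found M n i)) (snd (found M n i)) x"
  \<comment> \<open>This is the height of H x above -M measured in steps, so that H x \<le> level i
    becomes t \<le> i.\<close>
  define t where "t = (H x + real M) * 2 ^ n"
  have level: "of_rat (level M n i) = real i / 2 ^ n - real M" for i
    by (simp add: level_def of_rat_diff of_rat_divide of_rat_power)
  have "\<bar>(\<Sum>i<2 * M * 2 ^ n. ?u i) - t\<bar> \<le> 1"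
  proof (rule sum_ramps_approx)
    show "?u i = 0" if "t \<le> real i" for i
      using that by (intro cut_sound(1)[OF cut_found assms(1)]) (simp add: level t_def field_simps)
    show "?u i = 1" if "real i + 1 \<le> t" for i
      using that by (intro cut_sound(2)[OF cut_found assms(1)]) (simp add: level t_def field_simps)
    show "0 \<le> t"
      using assms(2) by (simp add: t_def abs_less_iff)
    have "(H x + real M) * 2 ^ n < (2 * real M) * 2 ^ n"
      using assms(2) by (intro mult_strict_right_mono) (auto simp: abs_less_iff)
    then show "t < real (2 * M * 2 ^ n)"
      by (simp add: t_def)
  qed (rule ramp_bounds)+
  then have "\<bar>(\<Sum>i<2 * M * 2 ^ n. ?u i) - t\<bar> / 2 ^ n \<le> 1 / 2 ^ n"
    by (rule divide_right_mono) simp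
  moreover have "stair M n x - H x = ((\<Sum>i<2 * M * 2 ^ n. ?u i) - t) / 2 ^ n"
    by (simp add: stair_def t_def field_simps)
  ultimately show ?thesis
    by (simp add: abs_divide)
qed

text \<open>Compactness yields M without a procedure for finding it; it is built into the programs
  as a constant.\<close>

lemma bounded_H: "\<exists>M. \<forall>x\<in>C. \<bar>H x\<bar> < real M"
proof -
  have "bounded (H ` C)"
    by (intro compact_imp_bounded compact_continuous_image continuous compact)
  then obtain K where "\<And>x. x \<in> C \<Longrightarrow> \<bar>H x\<bar> \<le> K"
    unfolding bounded_iff by auto
  moreover obtain M where "K < real M"
    using reals_Archimedean2 by blast
  ultimately show ?thesis
    by (meson order_le_less_trans)
qed

section \<open>The limit of the clamped approximations\<close>

lemma monotone_extension:
  obtains w where "computable_real (\<lambda>x. if x \<in> {0..1} then Some (w x) else None)"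
    "mono w" "\<And>x. x \<in> C \<Longrightarrow> w x = H x"
proof -
  obtain M where M: "\<And>x. x \<in> C \<Longrightarrow> \<bar>H x\<bar> < real M"
    using bounded_H by blast
  let ?f = "clamped (stair M) :: nat \<Rightarrow> real \<Rightarrow> real"
  obtain w where lim: "\<And>x. (\<lambda>n. ?f n x) \<longlonglongrightarrow> w x" and w: "\<And>n x. \<bar>?f n x - w x\<bar> \<le> 2 / 2 ^ n"
    using clamped_limit[of "stair M"] by blast
  define K :: "nat \<Rightarrow> nat" where "K n = (\<Sum>m<Suc n. \<Sum>i<2 * M * 2 ^ m. 2 ^ fst (found M m i))" for n
  show thesis
  proof
    show "computable_real (\<lambda>x. if x \<in> {0..1} then Some (w x) else None)"
    proof (rule computable_real_limit)
      show "computable (\<lambda>y. clamped (stair M) (fst y) (snd y) :: rat)"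
        by (intro computable_intros)
      show "computable K"
        unfolding K_def by (intro computable_intros)
      show "real_of_rat (clamped (stair M) n q) = ?f n (of_rat q)" for n q
        by (rule of_rat_clamped) (rule of_rat_stair)
      show "\<bar>?f n x - ?f n y\<bar> \<le> real (K n) * \<bar>x - y\<bar>" for n x y
        using clamped_lipschitz[of "stair M" x y, OF stair_lipschitz of_nat_0_le_iff, of n]
        by (simp only: K_def of_nat_sum)
    qed (rule w)
    show "mono w"
      by (intro monoI LIMSEQ_le[OF lim lim] exI[of _ 0] allI impI clamped_mono stair_mono)
    show "w x = H x" if "x \<in> C" for x
    proof (rule LIMSEQ_unique[OF lim])
      have le: "\<bar>?f n x - H x\<bar> \<le> (1 / 2) ^ n" for n
        using clamped_approx[of "stair M" x "H x" n] stair_approx[OF that M[OF that]]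
        by (simp add: power_one_over)
      have "(\<lambda>n. (1 / 2 :: real) ^ n) \<longlonglongrightarrow> 0"
        by (rule LIMSEQ_power_zero) simp
      then have "(\<lambda>n. ?f n x - H x) \<longlonglongrightarrow> 0"
        by (rule Lim_null_comparison[rotated]) (simp add: le)
      then show "(\<lambda>n. ?f n x) \<longlonglongrightarrow> H x"
        by (rule LIM_zero_cancel)
    qed
  qed
qed

end

theorem theorem4p5:
  fixes h :: "real \<rightharpoonup> real" and C :: "real set"
  assumes "dom h \<subseteq> {0..1}"
    and "computable_real h"
    and "effectively_closed C"
    and "C \<subseteq> {0..1}"
    and "C \<subseteq> dom h"
    and "mono_on C (\<lambda>x. the (h x))"
  shows "\<exists>hhat :: real \<rightharpoonup> real.
           dom hhat = {0..1} \<and> computable_real hhat \<and>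
           mono_on {0..1} (\<lambda>x. the (hhat x)) \<and>
           (\<forall>x\<in>C. hhat x = h x)"
proof -
  obtain p where p: "\<And>x y \<alpha>. h x = Some y \<Longrightarrow> cauchy_name \<alpha> x \<Longrightarrow>
      \<exists>\<beta>. (\<forall>n. eval \<alpha> p [n] = Some (\<beta> n)) \<and> cauchy_name \<beta> y"
    using assms(2) unfolding computable_real_def by blast
  obtain a b where "computable_rat_seq a" "computable_rat_seq b"
    and "- C = (\<Union>i. {real_of_rat (a i) <..< real_of_rat (b i)})"
    using assms(3) unfolding effectively_closed_def by blast
  then interpret computable_monotone h C p a b
    using p assms(4-6) by unfold_locales (simp_all add: computable_of_computable_rat_seq)
  obtain w where w: "computable_real (\<lambda>x. if x \<in> {0..1} then Some (w x) else None)"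
    "mono w" "\<And>x. x \<in> C \<Longrightarrow> w x = the (h x)"
    by (rule monotone_extension) blast
  let ?hhat = "\<lambda>x. if x \<in> {0..1} then Some (w x) else None"
  have "dom ?hhat = {0..1}"
    by (auto split: if_splits)
  moreover have "mono_on {0..1} (\<lambda>x. the (?hhat x))"
    using w(2) by (auto simp: mono_on_def mono_def)
  moreover have "\<forall>x\<in>C. ?hhat x = h x"
    using w(3) assms(4,5) by fastforce
  ultimately show ?thesis
    using w(1) by blast
qed

end
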